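(* Let $\mathcal{P}=\{P_n:n<\omega\}$ be a partition of $\omega$ into infinite sets with $\min P_i<\min P_j$ whenever $i<j$, and let $\mathcal{I}=(I_n)_{n<\omega}$ be a sequence of subsets of $\omega$ with $n\in I_n$ for all $n$. Let $\mathcal{E}^{\mathcal{P},\mathcal{I}}_\infty$ be the set of all equivalence relations $E$ on $\omega$ such that (a) $E$ has infinitely many classes, (b) for all $k,n<\omega$, $p_k(E)\in P_n$ iff $n$ is the largest integer with $2^n$ dividing $k+1$, and (c) for every $n$ and every class $X$ of $E$ with $\min X\in P_n$, $X\subseteq\bigcup\{P_m:m\in I_n\}$. Then $(\mathcal{E}^{\mathcal{P},\mathcal{I}}_\infty,\le,r)$ is a topological Ramsey space.
   Context: For an equivalence relation $E$ on $\omega$, $(p_k(E))_{k<\omega}$ is the increasing enumeration of the minimal elements of its classes. For equivalence relations on the same set, $E\le F$ means every $E$-class is a union of $F$-classes. For a set $\mathcal{R}$ of equivalence relations on $\omega$ with infinitely many classes: $r_n(E)=E\restriction\{0,\dots,p_n(E)-1\}$; $\mathcal{AR}$ is the set of all $r_n(E)$, $E\in\mathcal{R}$; for $a\in\mathcal{AR}$, $B\in\mathcal{R}$, $[a,B]=\{A\in\mathcal{R}:A\le B,\ r_n(A)=a\text{ for some }n\}$. The Ellentuck topology on $\mathcal{R}$ is generated by the sets $[a,B]$. $\mathcal{X}\subseteq\mathcal{R}$ has the property of Baire if $\mathcal{X}=\mathcal{O}\triangle M$ with $\mathcal{O}$ Ellentuck open and $M$ Ellentuck meagre; $\mathcal{X}$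 is Ramsey if for every non-empty $[a,B]$ there is $A\in[a,B]$ with $[a,A]\subseteq\mathcal{X}$ or $[a,A]\cap\mathcal{X}=\emptyset$, and Ramsey null if the second alternative can always be achieved. $(\mathcal{R},\le,r)$ is a topological Ramsey space if a subset of $\mathcal{R}$ has the property of Baire iff it is Ramsey, and is Ellentuck meagre iff it is Ramsey null. *)

theory Defs
  imports "HOL-Analysis.Analysis" "HOL-Library.Infinite_Set" "HOL-Library.Disjoint_Sets"
begin

section \<open>Equivalence relations on the natural numbers\<close>

type_synonym eqrel = "(nat \<times> nat) set"

text \<open>On \<^typ>\<open>nat set\<close>, \<^const>\<open>Inf\<close> is the least element of a non-empty set.\<close>

definition class_minima :: "eqrel \<Rightarrow> nat set" where
  "class_minima E = {Inf X |X. X \<in> UNIV // E}"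

definition p :: "nat \<Rightarrow> eqrel \<Rightarrow> nat" where
  "p k E = enumerate (class_minima E) k"

definition coarser :: "eqrel \<Rightarrow> eqrel \<Rightarrow> bool" where
  "coarser E F \<longleftrightarrow> (\<forall>X \<in> UNIV // E. \<exists>\<C> \<subseteq> UNIV // F. X = \<Union>\<C>)"

text \<open>A restriction contains the diagonal of the initial segment it lives on, so the set of pairs
  determines that segment.\<close>

definition r :: "nat \<Rightarrow> eqrel \<Rightarrow> eqrel" where
  "r n E = E \<inter> ({..<p n E} \<times> {..<p n E})"

section \<open>Topological Ramsey spaces of equivalence relations\<close>

text \<open>In this section \<open>R\<close> is meant to be a set of equivalence relations on \<^typ>\<open>nat\<close>
  with infinitely many classes.\<close>

definition AR :: "eqrel set \<Rightarrow> eqrel set" where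
  "AR R = {r n E |n E. E \<in> R}"

definition basic :: "eqrel set \<Rightarrow> eqrel \<Rightarrow> eqrel \<Rightarrow> eqrel set" where
  "basic R a B = {A \<in> R. coarser A B \<and> (\<exists>n. r n A = a)}"

text \<open>The underlying set of this topology is \<open>R\<close>, as every \<open>A \<in> R\<close> lies in
  \<open>basic R (r 0 A) A\<close>.\<close>

definition ellentuck :: "eqrel set \<Rightarrow> eqrel topology" where
  "ellentuck R = topology_generated_by {basic R a B |a B. a \<in> AR R \<and> B \<in> R}"

definition nowhere_dense_in :: "'a topology \<Rightarrow> 'a set \<Rightarrow> bool" where
  "nowhere_dense_in T S \<longleftrightarrow> S \<subseteq> topspace T \<and> T interior_of (T closure_of S) = {}"

definition meagre_in :: "'a topology \<Rightarrow> 'a set \<Rightarrow> bool" where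
  "meagre_in T S \<longleftrightarrow> (\<exists>\<N>. countable \<N> \<and> (\<forall>N \<in> \<N>. nowhere_dense_in T N) \<and> S = \<Union>\<N>)"

definition baire_property_in :: "'a topology \<Rightarrow> 'a set \<Rightarrow> bool" where
  "baire_property_in T S \<longleftrightarrow> (\<exists>U M. openin T U \<and> meagre_in T M \<and> S = sym_diff U M)"

definition ramsey :: "eqrel set \<Rightarrow> eqrel set \<Rightarrow> bool" where
  "ramsey R \<X> \<longleftrightarrow> (\<forall>a \<in> AR R. \<forall>B \<in> R. basic R a B \<noteq> {} \<longrightarrow>
     (\<exists>A \<in> basic R a B. basic R a A \<subseteq> \<X> \<or> basic R a A \<inter> \<X> = {}))"

definition ramsey_null :: "eqrel set \<Rightarrow> eqrel set \<Rightarrow> bool" where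
  "ramsey_null R \<X> \<longleftrightarrow> (\<forall>a \<in> AR R. \<forall>B \<in> R. basic R a B \<noteq> {} \<longrightarrow>
     (\<exists>A \<in> basic R a B. basic R a A \<inter> \<X> = {}))"

definition topological_ramsey_space :: "eqrel set \<Rightarrow> bool" where
  "topological_ramsey_space R \<longleftrightarrow>
     (\<forall>\<X> \<subseteq> R. (baire_property_in (ellentuck R) \<X> \<longleftrightarrow> ramsey R \<X>) \<and>
               (meagre_in (ellentuck R) \<X> \<longleftrightarrow> ramsey_null R \<X>))"

section \<open>The spaces given by a partition and a sequence of sets\<close>

definition E_infty :: "(nat \<Rightarrow> nat set) \<Rightarrow> (nat \<Rightarrow> nat set) \<Rightarrow> eqrel set" where
  "E_infty P I = {E. equiv UNIV E \<and> infinite (UNIV // E) \<and>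
     (\<forall>k n. p k E \<in> P n \<longleftrightarrow> 2 ^ n dvd k + 1 \<and> (\<forall>m. 2 ^ m dvd k + 1 \<longrightarrow> m \<le> n)) \<and>
     (\<forall>n. \<forall>X \<in> UNIV // E. Inf X \<in> P n \<longrightarrow> X \<subseteq> (\<Union>m \<in> I n. P m))}"

end

theory Submission
  imports Defs
begin

text \<open>
  Let \<open>col x = n\<close> for \<open>x \<in> P n\<close> and let \<open>c k\<close> be the exponent of \<open>2\<close> in \<open>k + 1\<close>. The only property of \<open>c\<close> that
  matters is that every value is taken infinitely often. The axioms A.3 and A.4 of topological Ramsey spaces can
  fail here, as a class may be impossible to absorb into the finitely many classes of an approximation.
  This is repaired by a dichotomy: below every \<open>[a, B]\<close> there is an \<open>A\<close> with \<open>[a, A] = {A}\<close>, where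
  nothing has to be proved, or there are \<open>A\<close> and \<open>K\<close> such that, for all members of \<open>[a, A]\<close>, every class can be
  absorbed into one of the first \<open>K + 1\<close> classes. In the second case the pigeonhole principle is a
  Carlson--Simpson theorem for left-variable words whose letters are restricted by the position. It is proved with an
  idempotent ultrafilter \<open>U\<close> on constant words in a minimal left ideal, together with ultrafilters \<open>V n\<close> on
  left-variable words of colour \<open>n\<close> all of whose instances \<open>V n[a]\<close> satisfy \<open>U * V n[a] = U\<close>. From there
  the usual route (combinatorial forcing for open sets, fusion for countable unions) applies.
\<close>

section \<open>Equivalence relations, minima and indices\<close>

text \<open>Words enter as follows. A coarsening of \<open>A\<close> that continues a given
  approximation of length \<open>k\<close> has to tell, for each later class of \<open>A\<close> up
  to its next minimum, which of its first \<open>k + 1\<close> classes absorbs it. The classes of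
  \<open>A\<close> are the positions, the absorbing classes the constants, the classes of a relation
  still to be coarsened the variables. The constants allowed depend on the position, and a new class
  may begin only at a position of the right colour; hence one ultrafilter on variable words per
  colour, all acting on the same \<open>U\<close>. The law \<open>U * V n[a] = U\<close> is what
  allows them to be mixed: it turns \<open>U\<close> into \<open>U * V n[a] * U\<close>, so that a
  word with \<open>U\<close>-many good continuations keeps them after any allowed instance of a
  variable of any colour is inserted, while the colouring is read only where variables of one colour
  start. The left ideal is taken minimal because each of its idempotents is a right identity for all
  its elements.\<close>

definition inf_equiv :: "eqrel \<Rightarrow> bool" where
  "inf_equiv E \<longleftrightarrow> equiv UNIV E \<and> infinite (UNIV // E)"

definition lead :: "eqrel \<Rightarrow> nat \<Rightarrow> nat" where
  "lead E x = Inf (E `` {x})"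

definition idx :: "eqrel \<Rightarrow> nat \<Rightarrow> nat" where
  "idx E x = card (class_minima E \<inter> {..<lead E x})"

lemma lead_rel:
  assumes "equiv UNIV E"
  shows "(x, lead E x) \<in> E"
proof -
  have "x \<in> E `` {x}"
    using assms by (auto simp: equiv_def refl_on_def)
  then have "Inf (E `` {x}) \<in> E `` {x}"
    by (intro Inf_nat_def1) auto
  then show ?thesis by (simp add: lead_def)
qed

lemma lead_least: "(x, y) \<in> E \<Longrightarrow> lead E x \<le> y"
  unfolding lead_def by (rule cInf_lower) auto

lemma lead_le: "equiv UNIV E \<Longrightarrow> lead E x \<le> x"
  by (rule lead_least) (auto simp: equiv_def refl_on_def)

lemma lead_eq_iff:
  assumes "equiv UNIV E"
  shows "lead E x = lead E y \<longleftrightarrow> (x, y) \<in> E"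
proof
  assume "lead E x = lead E y"
  then have "(x, lead E y) \<in> E" "(y, lead E y) \<in> E"
    using lead_rel[OF assms, of x] lead_rel[OF assms, of y] by auto
  then show "(x, y) \<in> E"
    using assms by (meson equivE symE transE)
next
  assume "(x, y) \<in> E"
  then show "lead E x = lead E y"
    using equiv_class_eq[OF assms] by (simp add: lead_def)
qed

lemma lead_lead: "equiv UNIV E \<Longrightarrow> lead E (lead E x) = lead E x"
  by (metis lead_eq_iff lead_rel)

lemma class_minima_eq_range: "class_minima E = range (lead E)"
  by (auto simp: class_minima_def lead_def quotient_def)

lemma class_minima_iff: "equiv UNIV E \<Longrightarrow> x \<in> class_minima E \<longleftrightarrow> lead E x = x"
  using lead_lead[of E] by (auto simp: class_minima_eq_range) (metis rangeI)

lemma infinite_class_minima_iff: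
  assumes "equiv UNIV E"
  shows "infinite (class_minima E) \<longleftrightarrow> infinite (UNIV // E)"
proof -
  have "class_minima E = Inf ` (UNIV // E)"
    by (auto simp: class_minima_def)
  moreover have "inj_on Inf (UNIV // E)"
  proof (rule inj_onI)
    fix X Y assume "X \<in> UNIV // E" "Y \<in> UNIV // E" and eq: "Inf X = Inf Y"
    then obtain x y where "X = E `` {x}" "Y = E `` {y}"
      by (auto simp: quotient_def)
    with eq show "X = Y"
      using equiv_class_eq[OF assms] lead_eq_iff[OF assms, of x y] by (simp add: lead_def)
  qed
  ultimately show ?thesis
    by (simp add: finite_image_iff)
qed

lemma inf_equivD: "inf_equiv E \<Longrightarrow> equiv UNIV E"
  by (simp add: inf_equiv_def)

lemma inf_equiv_minima: "inf_equiv E \<Longrightarrow> infinite (class_minima E)"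
  by (simp add: inf_equiv_def infinite_class_minima_iff)

lemma strict_mono_p: "inf_equiv E \<Longrightarrow> strict_mono (\<lambda>k. p k E)"
  unfolding p_def by (rule strict_mono_enumerate) (rule inf_equiv_minima)

lemma p_less_iff: "inf_equiv E \<Longrightarrow> p i E < p j E \<longleftrightarrow> i < j"
  using strict_mono_less[OF strict_mono_p] by blast

lemma p_le_iff: "inf_equiv E \<Longrightarrow> p i E \<le> p j E \<longleftrightarrow> i \<le> j"
  using strict_mono_less_eq[OF strict_mono_p] by blast

lemma p_eq_iff: "inf_equiv E \<Longrightarrow> p i E = p j E \<longleftrightarrow> i = j"
  using strict_mono_eq[OF strict_mono_p] by blast

lemma le_p: "inf_equiv E \<Longrightarrow> k \<le> p k E"
  using strict_mono_imp_increasing[OF strict_mono_p] .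

lemma range_p: "inf_equiv E \<Longrightarrow> range (\<lambda>k. p k E) = class_minima E"
  unfolding p_def using range_enumerate[OF inf_equiv_minima] .

lemma lead_p: "inf_equiv E \<Longrightarrow> lead E (p k E) = p k E"
  using range_p class_minima_iff inf_equivD by blast

lemma minima_below_p:
  assumes "inf_equiv E"
  shows "class_minima E \<inter> {..<p k E} = (\<lambda>i. p i E) ` {..<k}"
  by (auto simp: range_p[OF assms, symmetric] p_less_iff[OF assms])

lemma card_minima_below_p: "inf_equiv E \<Longrightarrow> card (class_minima E \<inter> {..<p k E}) = k"
  unfolding minima_below_p
  by (subst card_image) (auto simp: inj_on_def p_eq_iff)

lemma idx_p: "inf_equiv E \<Longrightarrow> idx E (p k E) = k"
  by (simp add: idx_def lead_p card_minima_below_p)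

lemma p_idx:
  assumes "inf_equiv E"
  shows "p (idx E x) E = lead E x"
proof -
  have "lead E x \<in> range (\<lambda>k. p k E)"
    by (simp add: range_p[OF assms] class_minima_eq_range)
  then obtain k where "lead E x = p k E" by blast
  then show ?thesis
    using assms by (simp add: idx_def card_minima_below_p)
qed

lemma p_idx_le: "inf_equiv E \<Longrightarrow> p (idx E x) E \<le> x"
  by (simp add: p_idx lead_le inf_equivD)

lemma idx_eq_iff: "inf_equiv E \<Longrightarrow> idx E x = idx E y \<longleftrightarrow> (x, y) \<in> E"
  using p_idx[of E x] p_idx[of E y] p_eq_iff[of E "idx E x" "idx E y"]
    lead_eq_iff[OF inf_equivD, of E x y] by simp

lemma idx_less: "inf_equiv E \<Longrightarrow> x < p k E \<Longrightarrow> idx E x < k"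
  by (metis p_idx_le p_less_iff le_less_trans)

lemma rel_p_idx: "inf_equiv E \<Longrightarrow> (x, p (idx E x) E) \<in> E"
  by (simp add: idx_eq_iff[symmetric] idx_p)

lemma minima_enumeration:
  assumes "inf_equiv E" "strict_mono m" "class_minima E = range m"
  shows "p k E = m k"
proof -
  have "m ` {..<k} = class_minima E \<inter> {..<m k}"
    using assms(2,3) by (auto simp: strict_mono_less)
  moreover have "card (m ` {..<k}) = k"
    using assms(2) by (subst card_image) (auto simp: inj_on_def strict_mono_eq)
  moreover have "m k \<in> class_minima E"
    using assms(3) by simp
  ultimately have "idx E (m k) = k"
    using assms(1) by (simp add: idx_def class_minima_iff inf_equivD)
  with \<open>m k \<in> class_minima E\<close> show ?thesis
    using p_idx[OF assms(1), of "m k"] assms(1) by (simp add: class_minima_iff inf_equivD)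
qed

section \<open>Relations given by class-index functions\<close>

definition ker :: "(nat \<Rightarrow> nat) \<Rightarrow> eqrel" where
  "ker f = {(x, y). f x = f y}"

text \<open>The hypotheses say that \<open>m t\<close> is the least element of the fibre of
  \<open>t\<close> and that the fibres are numbered in the order of their minima, so
  \<open>f\<close> is the index function of its own kernel. All new relations below are given by
  such a pair.\<close>

lemma ker_facts:
  assumes m: "strict_mono m" and fm: "\<And>t. f (m t) = t" and le: "\<And>x. m (f x) \<le> x"
  shows inf_equiv_ker: "inf_equiv (ker f)" and p_ker: "p t (ker f) = m t"
    and idx_ker: "idx (ker f) x = f x"
proof -
  have eq: "equiv UNIV (ker f)"
    by (auto simp: equiv_def refl_on_def sym_def trans_def ker_def)
  have lead: "lead (ker f) x = m (f x)" for x
  proof (rule antisym)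
    show "lead (ker f) x \<le> m (f x)"
      by (rule lead_least) (simp add: ker_def fm)
    have "f x = f (lead (ker f) x)"
      using lead_rel[OF eq, of x] by (simp add: ker_def)
    then show "m (f x) \<le> lead (ker f) x"
      using le[of "lead (ker f) x"] by simp
  qed
  have rng: "class_minima (ker f) = range m"
    unfolding class_minima_eq_range lead using fm by (auto simp: image_iff) metis
  moreover have "infinite (range m)"
    using m by (simp add: finite_image_iff strict_mono_imp_inj_on)
  ultimately show ie: "inf_equiv (ker f)"
    using eq by (simp add: inf_equiv_def flip: infinite_class_minima_iff)
  show pk: "p t (ker f) = m t" for t
    by (rule minima_enumeration[OF ie m rng])
  show "idx (ker f) x = f x"
    using p_idx[OF ie, of x] by (simp add: lead flip: pk) (simp add: p_eq_iff[OF ie])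
qed

section \<open>Coarsening as reversed inclusion of graphs; comparison of approximations\<close>

lemma coarser_iff:
  assumes "equiv UNIV A" "equiv UNIV B"
  shows "coarser A B \<longleftrightarrow> B \<subseteq> A"
proof
  assume c: "coarser A B"
  show "B \<subseteq> A"
  proof (clarify)
    fix x y assume xy: "(x, y) \<in> B"
    have "A `` {x} \<in> UNIV // A" by (simp add: quotientI)
    then obtain C where C: "C \<subseteq> UNIV // B" "A `` {x} = \<Union>C"
      using c unfolding coarser_def by blast
    have "x \<in> A `` {x}"
      using assms(1) by (auto simp: equiv_def refl_on_def)
    then obtain X where X: "X \<in> C" "x \<in> X" using C by blast
    then have "y \<in> X"
      using C xy assms(2) by (metis Image_singleton_iff in_quotient_imp_closed subsetD)
    then show "(x, y) \<in> A" using X C by blast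
  qed
next
  assume le: "B \<subseteq> A"
  show "coarser A B"
    unfolding coarser_def
  proof
    fix X assume "X \<in> UNIV // A"
    then obtain x where x: "X = A `` {x}" by (auto simp: quotient_def)
    have "X = \<Union> ((\<lambda>y. B `` {y}) ` X)"
      using le assms unfolding x equiv_def refl_on_def trans_def by blast
    moreover have "(\<lambda>y. B `` {y}) ` X \<subseteq> UNIV // B"
      by (auto simp: quotient_def)
    ultimately show "\<exists>\<C>\<subseteq>UNIV // B. X = \<Union> \<C>" by blast
  qed
qed

text \<open>The diagonal pairs in \<open>r n E\<close> recover \<open>p n E\<close>. Below this
  bound both relations have the same minima, and \<open>n\<close> is their number.\<close>

lemma r_eqD:
  assumes E: "inf_equiv E" and F: "inf_equiv F" and eq: "r n E = r n' F"
  shows "n = n'" and "p n E = p n F" and "x < p n E \<Longrightarrow> idx E x = idx F x"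
proof -
  note eE = inf_equivD[OF E] and eF = inf_equivD[OF F]
  have refl: "(x, x) \<in> E" "(x, x) \<in> F" for x
    using eE eF by (auto simp: equiv_def refl_on_def)
  have "x < p n E \<longleftrightarrow> x < p n' F" for x
    using eq refl[of x] unfolding r_def by blast
  then have pp: "p n E = p n' F"
    by (metis linorder_neqE_nat less_irrefl)
  have EF: "(x, y) \<in> E \<longleftrightarrow> (x, y) \<in> F" if "x < p n E" "y < p n E" for x y
  proof -
    have "(x, y) \<in> E \<longleftrightarrow> (x, y) \<in> r n E" "(x, y) \<in> F \<longleftrightarrow> (x, y) \<in> r n' F"
      using that pp by (simp_all add: r_def)
    then show ?thesis using eq by simp
  qed
  have lead: "lead E x = lead F x" if "x < p n E" for x
  proof (rule antisym)
    have lt: "lead E x < p n E" "lead F x < p n E"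
      using that lead_le[OF eE, of x] lead_le[OF eF, of x] by linarith+
    show "lead E x \<le> lead F x"
      using lead_rel[OF eF, of x] EF[OF that lt(2)] by (simp add: lead_least)
    show "lead F x \<le> lead E x"
      using lead_rel[OF eE, of x] EF[OF that lt(1)] by (simp add: lead_least)
  qed
  have cm: "class_minima E \<inter> {..<y} = class_minima F \<inter> {..<y}" if "y \<le> p n E" for y
    using lead that by (auto simp: class_minima_iff eE eF)
  show nn: "n = n'"
    using card_minima_below_p[OF E, of n] card_minima_below_p[OF F, of n'] cm[OF le_refl] pp by simp
  then show "p n E = p n F" using pp by simp
  show "idx E x = idx F x" if "x < p n E"
    unfolding idx_def lead[OF that, symmetric]
    by (subst cm) (use that lead_le[OF eE, of x] in auto)
qed

lemma r_eqI:
  assumes E: "inf_equiv E" and F: "inf_equiv F" and "p n E = p n F"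
    and "\<And>x. x < p n E \<Longrightarrow> idx E x = idx F x"
  shows "r n E = r n F"
  using assms by (auto simp: r_def idx_eq_iff[symmetric])

lemma r_eq_p:
  assumes E: "inf_equiv E" and F: "inf_equiv F" and eq: "r n E = r n F" and "i \<le> n"
  shows "p i E = p i F"
proof (cases "i = n")
  case True
  then show ?thesis using r_eqD(2)[OF E F eq] by simp
next
  case False
  then have "i < n" using \<open>i \<le> n\<close> by simp
  have 1: "p i E < p n E" "p i F < p n F" using \<open>i < n\<close> p_less_iff E F by auto
  then have "idx F (p i E) = i" "idx E (p i F) = i"
    using r_eqD(3)[OF E F eq, of "p i E"] r_eqD(3)[OF E F eq, of "p i F"] r_eqD(2)[OF E F eq]
    by (simp_all add: idx_p E F)
  then show ?thesis
    using p_idx_le[OF F, of "p i E"] p_idx_le[OF E, of "p i F"] by simp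
qed

lemma r_eq_mono:
  assumes E: "inf_equiv E" and F: "inf_equiv F" and eq: "r n E = r n F" and "i \<le> n"
  shows "r i E = r i F"
proof (rule r_eqI[OF E F r_eq_p[OF assms]])
  fix x assume "x < p i E"
  then have "x < p n E" using p_le_iff[OF E, of i n] \<open>i \<le> n\<close> by linarith
  then show "idx E x = idx F x" by (rule r_eqD(3)[OF E F eq])
qed

text \<open>The minimum of an \<open>E\<close>-class is the minimum of one of the
  \<open>A\<close>-classes it consists of. Below it, \<open>A\<close> has at least as many minima as
  \<open>E\<close>, whence k \<le> j.\<close>

lemma coarser_p:
  assumes A: "inf_equiv A" and E: "inf_equiv E" and "A \<subseteq> E"
  obtains j where "p k E = p j A" "k \<le> j"
proof -
  have sub: "class_minima E \<subseteq> class_minima A"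
  proof
    fix x assume "x \<in> class_minima E"
    then have "x \<le> lead A x"
      using lead_rel[OF inf_equivD[OF A], of x] assms lead_least[of x "lead A x" E]
      by (auto simp: class_minima_iff inf_equivD)
    then show "x \<in> class_minima A"
      using lead_le[OF inf_equivD[OF A], of x] by (simp add: class_minima_iff inf_equivD A)
  qed
  have "p k E \<in> class_minima E" using range_p[OF E] by auto
  then obtain j where j: "p k E = p j A"
    using sub range_p[OF A] by (metis imageE subsetD)
  have "card (class_minima E \<inter> {..<p k E}) \<le> card (class_minima A \<inter> {..<p k E})"
    by (rule card_mono) (use sub in auto)
  then have "k \<le> j"
    by (simp add: card_minima_below_p E) (simp add: j card_minima_below_p A)
  then show thesis using that j by blast
qed

lemma coarser_p_le:
  assumes "inf_equiv A" "inf_equiv E" "A \<subseteq> E"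
  shows "p k A \<le> p k E"
proof -
  obtain j where "p k E = p j A" "k \<le> j" using coarser_p[OF assms] .
  then show ?thesis by (simp add: p_le_iff assms(1))
qed

text \<open>Below the common \<open>n\<close>-th minimum lie \<open>n\<close> minima of either
  relation, and those of \<open>E\<close> are among those of \<open>A\<close>; so they coincide and
  no two of these \<open>A\<close>-classes are merged. Keeping an approximation under coarsening
  thus amounts to keeping one number.\<close>

lemma coarser_eq_r:
  assumes A: "inf_equiv A" and E: "inf_equiv E" and AE: "A \<subseteq> E" and pp: "p n E = p n A"
  shows "r n E = r n A"
proof (rule r_eqI[OF E A pp])
  have eq: "(\<lambda>i. p i E) ` {..<n} = (\<lambda>i. p i A) ` {..<n}"
  proof (rule card_seteq)
    show "(\<lambda>i. p i E) ` {..<n} \<subseteq> (\<lambda>i. p i A) ` {..<n}"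
    proof clarify
      fix i assume "i < n"
      obtain j where "p i E = p j A" using coarser_p[OF A E AE] .
      moreover have "p i E < p n A" using \<open>i < n\<close> pp p_less_iff[OF E] by metis
      ultimately show "p i E \<in> (\<lambda>i. p i A) ` {..<n}" using p_less_iff[OF A] by auto
    qed
  qed (auto simp: card_image inj_on_def p_eq_iff A E)
  fix x assume x: "x < p n E"
  have pa: "p i A = p i E" if "i < n" for i
  proof -
    have "class_minima E \<inter> {..<p n E} = class_minima A \<inter> {..<p n E}"
      using minima_below_p[OF E, of n] minima_below_p[OF A, of n] eq pp by simp
    then have "class_minima E \<inter> {..<p i A} = class_minima A \<inter> {..<p i A}"
    proof -
      have "{..<p i A} = {..<p n E} \<inter> {..<p i A}"
        using that p_less_iff[OF A, of i n] pp by auto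
      with \<open>class_minima E \<inter> {..<p n E} = _\<close> show ?thesis by (metis Int_assoc)
    qed
    moreover have "p i A \<in> (\<lambda>i. p i E) ` {..<n}"
      unfolding eq using that by simp
    then obtain l where l: "p i A = p l E" by blast
    ultimately have "i = l"
      using l card_minima_below_p[OF A, of i] card_minima_below_p[OF E, of l] by simp
    then show ?thesis using l by simp
  qed
  have "idx A x < n" using x pp idx_less[OF A] by simp
  have "(x, p (idx A x) A) \<in> E" using rel_p_idx[OF A, of x] AE by auto
  then have "idx E x = idx E (p (idx A x) A)" by (simp add: idx_eq_iff[OF E])
  also have "\<dots> = idx A x" using pa[OF \<open>idx A x < n\<close>] idx_p[OF E] by simp
  finally show "idx E x = idx A x" .
qed

section \<open>Idempotent ultrafilters without topology\<close>

definition ultra :: "'a filter \<Rightarrow> bool" where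
  "ultra U \<longleftrightarrow> U \<noteq> bot \<and> (\<forall>P. eventually P U \<or> eventually (\<lambda>x. \<not> P x) U)"

lemma ultra_not_eventually: "ultra U \<Longrightarrow> \<not> eventually P U \<Longrightarrow> eventually (\<lambda>x. \<not> P x) U"
  by (auto simp: ultra_def)

lemma ultra_eq:
  assumes "ultra U" "V \<le> U" "V \<noteq> bot"
  shows "V = U"
proof (rule antisym[OF \<open>V \<le> U\<close>], rule filter_leI)
  fix P assume P: "eventually P V"
  show "eventually P U"
  proof (rule ccontr)
    assume "\<not> eventually P U"
    then have "eventually (\<lambda>x. \<not> P x) V"
      using ultra_not_eventually[OF assms(1)] filter_leD[OF assms(2)] by blast
    with P have "eventually (\<lambda>x. False) V"
      by eventually_elim simp
    then show False using \<open>V \<noteq> bot\<close> by (simp add: eventually_False)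
  qed
qed

lemma ultra_filtermap: "ultra U \<Longrightarrow> ultra (filtermap f U)"
  by (simp add: ultra_def filtermap_bot_iff eventually_filtermap)

text \<open>A filter stands for the closed set of ultrafilters below it, so a smaller filter is a
  smaller closed set. Zorn's lemma gives minimal closed sets for a property that survives
  intersections of chains.\<close>

lemma minimal_filter:
  fixes S :: "'a filter set"
  assumes "F0 \<in> S"
    and chain: "\<And>C. C \<noteq> {} \<Longrightarrow> C \<subseteq> S \<Longrightarrow> (\<And>F G. F \<in> C \<Longrightarrow> G \<in> C \<Longrightarrow> F \<le> G \<or> G \<le> F) \<Longrightarrow> Inf C \<in> S"
  obtains F where "F \<in> S" "F \<le> F0" "\<And>G. G \<in> S \<Longrightarrow> G \<le> F \<Longrightarrow> G = F"
proof -
  define A where "A = {F \<in> S. F \<le> F0}"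
  have "\<exists>m\<in>A. \<forall>a\<in>A. a \<le> m \<longrightarrow> a = m"
  proof (rule predicate_Zorn)
    show "partial_order_on A (relation_of (\<lambda>x y. y \<le> x) A)"
      by (rule partial_order_on_relation_ofI) auto
    fix C assume "C \<in> Chains (relation_of (\<lambda>x y. y \<le> x) A)"
    then have C: "C \<subseteq> A" "\<And>F G. F \<in> C \<Longrightarrow> G \<in> C \<Longrightarrow> F \<le> G \<or> G \<le> F"
      by (auto simp: Chains_def relation_of_def)
    show "\<exists>u\<in>A. \<forall>a\<in>C. u \<le> a"
    proof (cases "C = {}")
      case True
      then show ?thesis using assms(1) by (auto simp: A_def)
    next
      case False
      then have "Inf C \<in> S" using C by (intro chain) (auto simp: A_def)
      moreover have "Inf C \<le> F0" using False C by (auto simp: A_def intro: Inf_lower2)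
      ultimately show ?thesis by (auto simp: A_def intro: Inf_lower)
    qed
  qed
  then show thesis using that by (auto simp: A_def)
qed

lemma eventually_Inf_chain:
  assumes "C \<noteq> {}" "\<And>F G. F \<in> C \<Longrightarrow> G \<in> C \<Longrightarrow> F \<le> G \<or> G \<le> F"
  shows "eventually P (Inf C) \<longleftrightarrow> (\<exists>F\<in>C. eventually P F)"
proof (rule eventually_Inf_base[OF assms(1)])
  fix F G assume "F \<in> C" "G \<in> C"
  then show "\<exists>x\<in>C. x \<le> inf F G"
    using assms(2)[of F G] by (metis inf.absorb1 inf.absorb2 order_refl)
qed

text \<open>Compactness of the space of ultrafilters in filter form: a chain of non-empty closed
  sets has a non-empty intersection.\<close>

lemma Inf_chain_neq_bot:
  fixes C :: "'a filter set"
  assumes "C \<noteq> {}" "\<And>F G. F \<in> C \<Longrightarrow> G \<in> C \<Longrightarrow> F \<le> G \<or> G \<le> F" "bot \<notin> C"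
  shows "Inf C \<noteq> bot"
proof -
  have "\<not> (\<exists>F\<in>C. eventually (\<lambda>x. False) F)"
    using assms(3) by (metis eventually_False)
  then show ?thesis
    by (simp add: eventually_Inf_chain[OF assms(1,2)] flip: eventually_False)
qed

lemma ultra_exists:
  assumes "F \<noteq> bot"
  obtains U where "ultra U" "U \<le> F"
proof -
  obtain U where U: "U \<noteq> bot" "U \<le> F" and min: "\<And>G. G \<noteq> bot \<Longrightarrow> G \<le> U \<Longrightarrow> G = U"
  proof (rule minimal_filter[of F "- {bot}"])
    fix C :: "'a filter set"
    assume "C \<noteq> {}" "C \<subseteq> - {bot}" "\<And>F G. F \<in> C \<Longrightarrow> G \<in> C \<Longrightarrow> F \<le> G \<or> G \<le> F"
    then show "Inf C \<in> - {bot}" using Inf_chain_neq_bot[of C] by auto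
  qed (use assms in auto)
  have "eventually P U" if "\<not> eventually (\<lambda>x. \<not> P x) U" for P
  proof -
    have "inf U (principal {x. P x}) \<noteq> bot"
      using that by (auto simp: trivial_limit_def eventually_inf_principal)
    then have "inf U (principal {x. P x}) = U" by (rule min) simp
    then have "U \<le> principal {x. P x}" by (metis inf.cobounded2)
    then show ?thesis by (simp add: le_principal)
  qed
  then have "ultra U" using U by (auto simp: ultra_def)
  then show thesis using that U by blast
qed

section \<open>Products of filters, idempotents and minimal left ideals\<close>

context semigroup
begin

text \<open>On ultrafilters this is the product of the Stone-Cech compactification of the semigroup,
  with the quantifier of the left factor outermost.\<close>

definition conv :: "'a filter \<Rightarrow> 'a filter \<Rightarrow> 'a filter" where
  "conv F G = Abs_filter (\<lambda>P. eventually (\<lambda>s. eventually (\<lambda>t. P (f s t)) G) F)"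

lemma eventually_conv:
  "eventually P (conv F G) \<longleftrightarrow> eventually (\<lambda>s. eventually (\<lambda>t. P (f s t)) G) F"
  unfolding conv_def
proof (rule eventually_Abs_filter, rule is_filter.intro)
  fix P Q
  assume "\<forall>\<^sub>F s in F. \<forall>\<^sub>F t in G. P (f s t)" "\<forall>\<^sub>F s in F. \<forall>\<^sub>F t in G. Q (f s t)"
  then show "\<forall>\<^sub>F s in F. \<forall>\<^sub>F t in G. P (f s t) \<and> Q (f s t)"
    by eventually_elim (simp add: eventually_conj_iff)
next
  fix P Q :: "'a \<Rightarrow> bool"
  assume "\<forall>x. P x \<longrightarrow> Q x" "\<forall>\<^sub>F s in F. \<forall>\<^sub>F t in G. P (f s t)"
  then show "\<forall>\<^sub>F s in F. \<forall>\<^sub>F t in G. Q (f s t)"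
    by (elim eventually_mono) auto
qed simp

lemma conv_assoc: "conv (conv F G) H = conv F (conv G H)"
  by (simp add: filter_eq_iff eventually_conv assoc)

lemma conv_mono:
  assumes "F \<le> F'" "G \<le> G'"
  shows "conv F G \<le> conv F' G'"
proof (rule filter_leI)
  fix P assume "eventually P (conv F' G')"
  then have "\<forall>\<^sub>F s in F'. \<forall>\<^sub>F t in G. P (f s t)"
    unfolding eventually_conv by (rule eventually_mono) (rule filter_leD[OF assms(2)])
  then show "eventually P (conv F G)"
    unfolding eventually_conv by (rule filter_leD[OF assms(1)])
qed

lemma conv_neq_bot: "F \<noteq> bot \<Longrightarrow> G \<noteq> bot \<Longrightarrow> conv F G \<noteq> bot"
  by (simp add: eventually_conv flip: eventually_False)

lemma filtermap_conv:
  assumes "\<And>s t. h (f s t) = f (h s) (h t)"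
  shows "filtermap h (conv F G) = conv (filtermap h F) (filtermap h G)"
  by (simp add: filter_eq_iff eventually_filtermap eventually_conv assms)

text \<open>The Ellis--Numakura lemma, with closed sets of ultrafilters replaced by filters.\<close>

lemma idempotent_ultra:
  assumes "F0 \<noteq> bot" "conv F0 F0 \<le> F0"
  obtains U where "ultra U" "U \<le> F0" "conv U U = U"
proof -
  define S where "S = {F. F \<noteq> bot \<and> conv F F \<le> F}"
  obtain F where F: "F \<in> S" "F \<le> F0" and min: "\<And>G. G \<in> S \<Longrightarrow> G \<le> F \<Longrightarrow> G = F"
  proof (rule minimal_filter[of F0 S])
    fix C assume C: "C \<noteq> {}" "C \<subseteq> S" "\<And>F G. F \<in> C \<Longrightarrow> G \<in> C \<Longrightarrow> F \<le> G \<or> G \<le> F"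
    have "conv (Inf C) (Inf C) \<le> Inf C"
    proof (rule Inf_greatest)
      fix F assume "F \<in> C"
      then have "conv (Inf C) (Inf C) \<le> conv F F" by (intro conv_mono Inf_lower)
      also have "\<dots> \<le> F" using \<open>F \<in> C\<close> C(2) by (auto simp: S_def)
      finally show "conv (Inf C) (Inf C) \<le> F" .
    qed
    moreover have "Inf C \<noteq> bot" by (rule Inf_chain_neq_bot) (use C in \<open>auto simp: S_def\<close>)
    ultimately show "Inf C \<in> S" by (simp add: S_def)
  qed (use assms in \<open>auto simp: S_def\<close>)
  have nb: "F \<noteq> bot" and FF: "conv F F \<le> F" using F by (auto simp: S_def)
  obtain U where U: "ultra U" "U \<le> F" using ultra_exists[OF nb] .
  have Ub: "U \<noteq> bot" using U by (simp add: ultra_def)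
  have FU: "conv F U = F"
  proof (rule min)
    have "conv (conv F U) (conv F U) = conv F (conv (conv U F) U)"
      by (simp add: conv_assoc)
    also have "\<dots> \<le> conv F (conv F U)"
      by (intro conv_mono order_refl order_trans[OF conv_mono FF] U)
    also have "\<dots> \<le> conv F U"
      unfolding conv_assoc[symmetric] by (intro conv_mono order_refl FF)
    finally show "conv F U \<in> S" using nb Ub by (simp add: S_def conv_neq_bot)
    show "conv F U \<le> F" by (rule order_trans[OF conv_mono FF]) (use U in auto)
  qed
  \<comment> \<open>\<open>Inf B\<close> is the largest filter \<open>X\<close> with
    \<open>conv X U \<le> U\<close>, so \<open>G\<close> is the stabiliser of \<open>U\<close>
    inside \<open>F\<close>. It is closed under products, and \<open>conv F U = F\<close> makes it
    non-trivial. By minimality it is all of \<open>F\<close>, so \<open>U\<close> itself lies below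
    it.\<close>
  define B where "B = (\<lambda>P. principal {s. eventually (\<lambda>t. P (f s t)) U}) ` {P. eventually P U}"
  define G where "G = inf F (Inf B)"
  have Binf: "eventually Q (Inf B) \<longleftrightarrow>
      (\<exists>P. eventually P U \<and> (\<forall>s. eventually (\<lambda>t. P (f s t)) U \<longrightarrow> Q s))" for Q
  proof -
    have "eventually Q (Inf B) \<longleftrightarrow> (\<exists>b\<in>B. eventually Q b)"
    proof (rule eventually_Inf_base)
      show "B \<noteq> {}" by (auto simp: B_def intro: exI[of _ "\<lambda>_. True"])
      fix X Y assume "X \<in> B" "Y \<in> B"
      then obtain P P' where P: "eventually P U" "X = principal {s. eventually (\<lambda>t. P (f s t)) U}"
        and P': "eventually P' U" "Y = principal {s. eventually (\<lambda>t. P' (f s t)) U}"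
        by (auto simp: B_def)
      have "principal {s. eventually (\<lambda>t. P (f s t) \<and> P' (f s t)) U} \<le> inf X Y"
        by (auto simp: P P' eventually_conj_iff)
      moreover have "principal {s. eventually (\<lambda>t. P (f s t) \<and> P' (f s t)) U} \<in> B"
        unfolding B_def using P P' by (intro image_eqI[of _ _ "\<lambda>t. P t \<and> P' t"]) (auto intro: eventually_conj)
      ultimately show "\<exists>x\<in>B. x \<le> inf X Y" by blast
    qed
    then show ?thesis by (auto simp: B_def eventually_principal)
  qed
  have GU: "conv G U \<le> U"
  proof (rule filter_leI)
    fix P assume "eventually P U"
    then have "eventually (\<lambda>s. eventually (\<lambda>t. P (f s t)) U) (Inf B)"
      by (auto simp: Binf)
    then have "eventually (\<lambda>s. eventually (\<lambda>t. P (f s t)) U) G"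
      by (rule filter_leD[rotated]) (simp add: G_def)
    then show "eventually P (conv G U)" by (simp add: eventually_conv)
  qed
  have "G = F"
  proof (rule min)
    have "conv G G \<le> conv F F" by (intro conv_mono) (simp_all add: G_def)
    then have 1: "conv G G \<le> F" using FF by (rule order_trans)
    have "conv G G \<le> Inf B"
    proof (rule filter_leI)
      fix Q assume "eventually Q (Inf B)"
      then obtain P where P: "eventually P U" "\<And>s. eventually (\<lambda>t. P (f s t)) U \<Longrightarrow> Q s"
        by (auto simp: Binf)
      have "conv (conv G G) U \<le> U"
        unfolding conv_assoc by (rule order_trans[OF conv_mono[OF order_refl GU] GU])
      then have "eventually (\<lambda>s. eventually (\<lambda>t. P (f s t)) U) (conv G G)"
        using P(1) by (auto simp: eventually_conv[symmetric] dest: filter_leD)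
      then show "eventually Q (conv G G)" by (rule eventually_mono) (rule P(2))
    qed
    with 1 have "conv G G \<le> G" by (simp add: G_def)
    moreover have "G \<noteq> bot"
    proof
      assume "G = bot"
      then have "eventually (\<lambda>_. False) G" by simp
      then obtain Q R where QR: "eventually Q F" "eventually R (Inf B)" "\<And>x. Q x \<and> R x \<Longrightarrow> False"
        unfolding G_def eventually_inf by auto
      then obtain P where P: "eventually P U" "\<And>s. eventually (\<lambda>t. P (f s t)) U \<Longrightarrow> R s"
        by (auto simp: Binf)
      have "eventually (\<lambda>s. eventually (\<lambda>t. \<not> P (f s t)) U) F"
        using QR(1) by (rule eventually_mono) (use P(2) QR(3) ultra_not_eventually[OF U(1)] in blast)
      then have "eventually (\<lambda>t. \<not> P t) (conv F U)" by (simp add: eventually_conv)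
      then have "eventually (\<lambda>t. \<not> P t) U" using filter_leD[OF U(2)] by (simp add: FU)
      with P(1) have "eventually (\<lambda>t. False) U" by eventually_elim simp
      then show False using Ub by (simp add: eventually_False)
    qed
    ultimately show "G \<in> S" by (simp add: S_def)
    show "G \<le> F" by (simp add: G_def)
  qed
  then have "conv U U \<le> U"
    using GU by (intro order_trans[OF conv_mono[OF U(2) order_refl]]) simp
  then have "conv U U = U" by (rule ultra_eq[OF U(1)]) (rule conv_neq_bot[OF Ub Ub])
  then show thesis using that U F by force
qed

text \<open>For a non-trivial \<open>G\<close> below \<open>M\<close>, \<open>conv W G\<close> is
  again a left ideal inside \<open>M\<close>. The last clause is the form in which minimality is
  used.\<close>

lemma minimal_left_ideal:
  assumes "W \<noteq> bot" "conv W W \<le> W"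
  obtains M where "M \<noteq> bot" "M \<le> W" "conv W M \<le> M"
    "\<And>G. G \<noteq> bot \<Longrightarrow> G \<le> M \<Longrightarrow> conv W G = M"
proof -
  define S where "S = {F. F \<noteq> bot \<and> conv W F \<le> F}"
  obtain M where M: "M \<in> S" "M \<le> W" and min: "\<And>G. G \<in> S \<Longrightarrow> G \<le> M \<Longrightarrow> G = M"
  proof (rule minimal_filter[of W S])
    fix C assume C: "C \<noteq> {}" "C \<subseteq> S" "\<And>F G. F \<in> C \<Longrightarrow> G \<in> C \<Longrightarrow> F \<le> G \<or> G \<le> F"
    have "conv W (Inf C) \<le> Inf C"
    proof (rule Inf_greatest)
      fix F assume "F \<in> C"
      then have "conv W (Inf C) \<le> conv W F" by (intro conv_mono Inf_lower order_refl)
      also have "\<dots> \<le> F" using \<open>F \<in> C\<close> C(2) by (auto simp: S_def)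
      finally show "conv W (Inf C) \<le> F" .
    qed
    moreover have "Inf C \<noteq> bot" by (rule Inf_chain_neq_bot) (use C in \<open>auto simp: S_def\<close>)
    ultimately show "Inf C \<in> S" by (simp add: S_def)
  qed (use assms in \<open>auto simp: S_def\<close>)
  have "conv W G = M" if "G \<noteq> bot" "G \<le> M" for G
  proof (rule min)
    have "conv W (conv W G) \<le> conv W G"
      unfolding conv_assoc[symmetric] by (intro conv_mono assms order_refl)
    then show "conv W G \<in> S" using that assms by (simp add: S_def conv_neq_bot)
    have "conv W G \<le> conv W M" by (intro conv_mono that order_refl)
    then show "conv W G \<le> M" using M by (auto simp: S_def)
  qed
  then show thesis using that M by (auto simp: S_def)
qed

text \<open>Classically \<open>U\<close> is a product of some \<open>w\<close> with
  \<open>V\<close>, and idempotence of \<open>V\<close> finishes. With filters,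
  \<open>conv W V = M\<close> only says that every \<open>U\<close>-large set meets such products.
  So suppose the law fails for \<open>P\<close>: the points of \<open>P\<close> whose translate of
  \<open>P\<close> is not \<open>V\<close>-large form a \<open>U\<close>-large set \<open>Z\<close>,
  some \<open>w\<close> has \<open>f w u\<close> in \<open>Z\<close> for \<open>V\<close>-most
  \<open>u\<close>, and idempotence of \<open>V\<close> makes the translates at these points
  \<open>V\<close>-large after all.\<close>

lemma conv_idempotent_minimal:
  assumes min: "\<And>G. G \<noteq> bot \<Longrightarrow> G \<le> M \<Longrightarrow> conv W G = M"
    and U: "ultra U" "U \<le> M" and V: "ultra V" "V \<le> M" "conv V V = V"
  shows "conv U V = U"
proof (rule ultra_eq[OF U(1)])
  show "conv U V \<noteq> bot" using U V by (simp add: conv_neq_bot ultra_def)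
  show "conv U V \<le> U"
  proof (rule filter_leI, rule ccontr)
    fix P assume P: "eventually P U" and n: "\<not> eventually P (conv U V)"
    define Z where "Z = (\<lambda>s. P s \<and> \<not> eventually (\<lambda>t. P (f s t)) V)"
    have "eventually (\<lambda>s. \<not> eventually (\<lambda>t. P (f s t)) V) U"
      using n by (simp add: eventually_conv ultra_not_eventually[OF U(1)])
    with P have "eventually (\<lambda>s. P s \<and> \<not> eventually (\<lambda>t. P (f s t)) V) U"
      by (rule eventually_conj)
    then have Z: "eventually Z U"
      by (simp add: Z_def)
    have "conv W V = M" using V by (intro min) (auto simp: ultra_def)
    have "\<not> eventually (\<lambda>s. \<not> Z s) (conv W V)"
    proof
      assume "eventually (\<lambda>s. \<not> Z s) (conv W V)"
      then have "eventually (\<lambda>s. \<not> Z s) U"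
        using filter_leD[OF U(2)] \<open>conv W V = M\<close> by simp
      with Z have "eventually (\<lambda>s. False) U" by eventually_elim simp
      then show False using U(1) by (simp add: eventually_False ultra_def)
    qed
    then obtain w where "\<not> eventually (\<lambda>u. \<not> Z (f w u)) V"
      unfolding eventually_conv using eventuallyI[where F = W] by metis
    then have ev: "eventually (\<lambda>u. Z (f w u)) V"
      using ultra_not_eventually[OF V(1), of "\<lambda>u. \<not> Z (f w u)"] by simp
    then have "eventually (\<lambda>u. P (f w u)) V" by (rule eventually_mono) (simp add: Z_def)
    then have "eventually (\<lambda>u. P (f w u)) (conv V V)" by (simp add: V(3))
    then have "eventually (\<lambda>u. eventually (\<lambda>t. P (f (f w u) t)) V) V"
      by (simp add: eventually_conv assoc)
    with ev have "eventually (\<lambda>u. False) V" by eventually_elim (simp add: Z_def)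
    then show False using V(1) by (simp add: eventually_False ultra_def)
  qed
qed

text \<open>In the application \<open>W\<close> describes constant words, \<open>F n\<close>
  variable words of kind \<open>n\<close>, and \<open>\<Sigma> n\<close> the substitutions.
  \<open>V n\<close> is an idempotent all of whose images lie below \<open>M\<close>; these images
  are idempotents of a minimal left ideal, hence right identities for \<open>U\<close>.\<close>

theorem absorbing_ultrafilters:
  assumes W: "W \<noteq> bot" "conv W W \<le> W"
    and F: "\<And>n. F n \<noteq> bot" "\<And>n. conv (F n) (F n) \<le> F n" "\<And>n. conv (F n) W \<le> F n"
    and hom: "\<And>n h s t. h \<in> \<Sigma> n \<Longrightarrow> h (f s t) = f (h s) (h t)"
    and sub: "\<And>n h. h \<in> \<Sigma> n \<Longrightarrow> filtermap h (F n) \<le> W"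
    and const: "\<And>n h. h \<in> \<Sigma> n \<Longrightarrow> eventually (\<lambda>t. h t = t) W"
  obtains U V where "ultra U" "U \<le> W" "conv U U = U"
    "\<And>n. ultra (V n)" "\<And>n. V n \<le> F n" "\<And>n h. h \<in> \<Sigma> n \<Longrightarrow> conv U (filtermap h (V n)) = U"
proof -
  obtain M where M: "M \<noteq> bot" "M \<le> W" "conv W M \<le> M"
    and min: "\<And>G. G \<noteq> bot \<Longrightarrow> G \<le> M \<Longrightarrow> conv W G = M"
    using minimal_left_ideal[OF W] by blast
  have MM: "conv M M \<le> M"
    using conv_mono[OF M(2) order_refl, of M] M(3) by (rule order_trans)
  obtain U where U: "ultra U" "U \<le> M" "conv U U = U"
    using idempotent_ultra[OF M(1) MM] .
  have "\<exists>V. ultra V \<and> V \<le> F n \<and> (\<forall>h\<in>\<Sigma> n. conv U (filtermap h V) = U)" for n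
  proof -
    define Q where "Q = inf (F n) (INF h\<in>\<Sigma> n. filtercomap h M)"
    have le_Q: "X \<le> Q \<longleftrightarrow> X \<le> F n \<and> (\<forall>h\<in>\<Sigma> n. filtermap h X \<le> M)" for X
      by (simp add: Q_def le_INF_iff filtermap_le_iff_le_filtercomap)
    have "conv Q Q \<le> Q"
      unfolding le_Q
    proof (intro conjI ballI)
      have "conv Q Q \<le> conv (F n) (F n)" by (intro conv_mono) (simp_all add: Q_def)
      then show "conv Q Q \<le> F n" using F(2) by (rule order_trans)
      fix h assume h: "h \<in> \<Sigma> n"
      have "filtermap h Q \<le> M" using le_Q[of Q] h by simp
      then show "filtermap h (conv Q Q) \<le> M"
        unfolding filtermap_conv[of h, OF hom[OF h]] by (intro order_trans[OF conv_mono MM])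
    qed
    \<comment> \<open>This makes \<open>Q\<close> non-trivial: a substitution maps
      \<open>conv (F n) M\<close> below \<open>conv W M\<close>, as it turns variable words into
      constant ones and fixes almost all constant words.\<close>
    moreover have "conv (F n) M \<le> Q"
      unfolding le_Q
    proof (intro conjI ballI)
      show "conv (F n) M \<le> F n"
        using conv_mono[OF order_refl M(2), of "F n"] F(3) by (rule order_trans)
      fix h assume h: "h \<in> \<Sigma> n"
      have "filtermap h M \<le> M"
      proof (rule filter_leI)
        fix P assume "eventually P M"
        with filter_leD[OF M(2) const[OF h]] show "eventually P (filtermap h M)"
          unfolding eventually_filtermap by eventually_elim simp
      qed
      then show "filtermap h (conv (F n) M) \<le> M"
        unfolding filtermap_conv[of h, OF hom[OF h]]
        by (rule order_trans[OF conv_mono[OF sub[OF h]] M(3)])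
    qed
    then have "Q \<noteq> bot" using conv_neq_bot[OF F(1)[of n] M(1)] by (metis bot.extremum_uniqueI)
    ultimately obtain V where V: "ultra V" "V \<le> Q" "conv V V = V"
      using idempotent_ultra by blast
    have "conv U (filtermap h V) = U" if h: "h \<in> \<Sigma> n" for h
    proof (rule conv_idempotent_minimal[OF min U(1,2)])
      show "ultra (filtermap h V)" by (rule ultra_filtermap[OF V(1)])
      show "filtermap h V \<le> M" using V(2) h by (simp add: le_Q)
      show "conv (filtermap h V) (filtermap h V) = filtermap h V"
        by (simp add: filtermap_conv[of h, OF hom[OF h], symmetric] V(3))
    qed
    then show ?thesis using V by (auto simp: le_Q)
  qed
  then obtain V where "\<And>n. ultra (V n) \<and> V n \<le> F n \<and> (\<forall>h\<in>\<Sigma> n. conv U (filtermap h (V n)) = U)"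
    by metis
  then show thesis using that[of U V] U M(2) by (auto intro: order_trans)
qed

end

section \<open>Spaces of coloured equivalence relations\<close>

locale colored_equivs =
  fixes col c :: "nat \<Rightarrow> nat" and I :: "nat \<Rightarrow> nat set"
  assumes recurrent: "infinite {s. c s = c k}"
begin

text \<open>The minimum of the class of \<open>x\<close> has colour \<open>c (idx E x)\<close>,
  which turns the condition on classes into one on points.\<close>

definition R :: "eqrel set" where
  "R = {E. inf_equiv E \<and> (\<forall>k. col (p k E) = c k) \<and> (\<forall>x. col x \<in> I (c (idx E x)))}"

lemma R_inf_equiv: "E \<in> R \<Longrightarrow> inf_equiv E"
  and R_col: "E \<in> R \<Longrightarrow> col (p k E) = c k"
  and R_class: "E \<in> R \<Longrightarrow> col x \<in> I (c (idx E x))"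
  by (auto simp: R_def)

lemma ker_in_R:
  assumes "strict_mono m" "\<And>t. f (m t) = t" "\<And>x. m (f x) \<le> x"
    and "\<And>t. col (m t) = c t" "\<And>x. col x \<in> I (c (f x))"
  shows "ker f \<in> R"
  using ker_facts[of m f, OF assms(1-3)] assms(4,5) by (simp add: R_def)

lemma R_r_eqI:
  assumes "A \<in> R" "E \<in> R" "A \<subseteq> E" "p n E = p n A"
  shows "r n E = r n A"
  using coarser_eq_r assms R_inf_equiv by blast

lemma R_r_mono: "A \<in> R \<Longrightarrow> E \<in> R \<Longrightarrow> r n E = r n A \<Longrightarrow> i \<le> n \<Longrightarrow> r i E = r i A"
  using r_eq_mono R_inf_equiv by blast

lemma R_r_p: "A \<in> R \<Longrightarrow> E \<in> R \<Longrightarrow> r n E = r n A \<Longrightarrow> i \<le> n \<Longrightarrow> p i E = p i A"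
  using r_eq_p R_inf_equiv by blast

text \<open>The part of axiom A.3 that survives: past its first \<open>j\<close> classes
  \<open>A\<close> is coarsened at least as far as in \<open>E\<close>, so every continuation of
  \<open>r k E\<close> found below \<open>A'\<close> is coarser than \<open>E\<close>. That such a
  continuation exists is not asserted.\<close>

lemma amalgamation:
  assumes A: "A \<in> R" and E: "E \<in> R" and AE: "A \<subseteq> E" and pk: "p k E = p j A"
  shows "\<exists>A'\<in>R. A \<subseteq> A' \<and> r j A' = r j A \<and> (\<forall>F\<in>R. A' \<subseteq> F \<and> r k F = r k E \<longrightarrow> E \<subseteq> F)"
proof -
  note iA = R_inf_equiv[OF A] and iE = R_inf_equiv[OF E]
  \<comment> \<open>An \<open>E\<close>-class of index \<open>i\<close> with k < i \<le> j, kept as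
    a separate class, would get a new index, possibly with another value of \<open>c\<close>.
    Instead its part outside the first \<open>j\<close> classes of \<open>A\<close> joins class
    \<open>i\<close> of \<open>A'\<close>, which obeys the same restriction \<open>I (c i)\<close>.
    The classes of \<open>E\<close> beyond \<open>j\<close> keep their indices.\<close>
  define f where "f x = (if idx A x < j then idx A x
    else if idx E x \<le> k then idx A (p (idx E x) E) else idx E x)" for x
  define m where "m t = (if t \<le> j then p t A else p t E)" for t
  have kj: "k \<le> j"
    using coarser_p[OF iA iE AE, of k] pk by (metis p_eq_iff[OF iA])
  have pE: "p (idx A (p i E)) A = p i E" for i
    using coarser_p[OF iA iE AE, of i] by (metis idx_p[OF iA])
  have idxE: "idx E x = idx E (p (idx A x) A)" for x
    using rel_p_idx[OF iA, of x] AE idx_eq_iff[OF iE] by blast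
  have low: "idx E x < k" if "idx A x < j" for x
  proof -
    have "p (idx A x) A < p k E" using that pk by (simp add: p_less_iff[OF iA])
    then show ?thesis using idx_less[OF iE] idxE by metis
  qed
  have idxA_p: "idx A (p i E) \<le> j \<longleftrightarrow> i \<le> k" "idx A (p i E) < j \<longleftrightarrow> i < k" for i
    using pE[of i] pk p_le_iff[OF iA, of "idx A (p i E)" j] p_le_iff[OF iE, of i k]
      p_less_iff[OF iA, of "idx A (p i E)" j] p_less_iff[OF iE, of i k] by simp_all
  have mono: "strict_mono m"
  proof (rule strict_monoI)
    fix t t' :: nat assume "t < t'"
    have "p t A \<le> p k E" if "t \<le> j" using that pk p_le_iff[OF iA] by simp
    moreover have "p k E < p t' E" if "\<not> t' \<le> j" using that kj p_less_iff[OF iE] by simp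
    ultimately show "m t < m t'"
      using \<open>t < t'\<close> p_less_iff[OF iA, of t t'] p_less_iff[OF iE, of t t'] by (auto simp: m_def)
  qed
  have fm: "f (m t) = t" for t
  proof -
    consider "t < j" | "t = j" | "t > j" by linarith
    then show ?thesis
    proof cases
      case 1
      then show ?thesis by (simp add: f_def m_def idx_p[OF iA])
    next
      case 2
      then show ?thesis using idx_p[OF iE, of k] by (simp add: f_def m_def idx_p[OF iA] flip: pk) (simp add: pk idx_p[OF iA])
    next
      case 3
      then show ?thesis
        using kj idxA_p[of t] by (simp add: f_def m_def idx_p[OF iE])
    qed
  qed
  have mf: "m (f x) \<le> x" for x
  proof -
    have "p (idx E x) A \<le> x"
      using coarser_p_le[OF iA iE AE, of "idx E x"] p_idx_le[OF iE, of x] by simp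
    then show ?thesis
      using p_idx_le[OF iA, of x] p_idx_le[OF iE, of x] idxA_p[of "idx E x"] pE[of "idx E x"]
      by (auto simp: f_def m_def)
  qed
  have c_idx: "c (idx A (p i E)) = c i" for i
    using R_col[OF A, of "idx A (p i E)"] R_col[OF E, of i] pE[of i] by simp
  have R: "ker f \<in> R"
  proof (rule ker_in_R[OF mono fm mf])
    show "col (m t) = c t" for t using R_col[OF A] R_col[OF E] by (simp add: m_def)
    show "col x \<in> I (c (f x))" for x
      using R_class[OF A, of x] R_class[OF E, of x] by (simp add: f_def c_idx)
  qed
  have sub: "A \<subseteq> ker f"
  proof clarify
    fix x y assume "(x, y) \<in> A"
    then have "idx A x = idx A y" "idx E x = idx E y"
      using AE idx_eq_iff[OF iA] idx_eq_iff[OF iE] by auto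
    then show "(x, y) \<in> ker f" by (simp add: ker_def f_def)
  qed
  have "p j (ker f) = p j A"
    using p_ker[of m f, OF mono fm mf] by (simp add: m_def)
  then have rj: "r j (ker f) = r j A" by (rule R_r_eqI[OF A R sub])
  have "E \<subseteq> F" if F: "F \<in> R" "ker f \<subseteq> F" and rF: "r k F = r k E" for F
  proof -
    note iF = R_inf_equiv[OF F(1)]
    have main: "(x, p (idx E x) E) \<in> F" for x
    proof (cases "idx A x < j")
      case True
      have lt: "p (idx A x) A < p k E" using True pk by (simp add: p_less_iff[OF iA])
      then have "idx F (p (idx A x) A) = idx E x"
        using r_eqD(3)[OF iE iF rF[symmetric] lt] idxE[of x] by simp
      moreover have "idx F (p (idx E x) E) = idx E x"
        using r_eq_p[OF iF iE rF, of "idx E x"] low[OF True] idx_p[OF iF] by (metis less_imp_le)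
      ultimately have "(p (idx A x) A, p (idx E x) E) \<in> F"
        by (simp add: idx_eq_iff[OF iF, symmetric])
      moreover have "(x, p (idx A x) A) \<in> F"
        using rel_p_idx[OF iA, of x] sub F by auto
      ultimately show ?thesis
        using inf_equivD[OF iF] by (meson equivE transE)
    next
      case False
      have "f x = f (p (idx E x) E)"
        using False idxA_p[of "idx E x"] by (auto simp: f_def idx_p[OF iE] not_less)
      then show ?thesis using F(2) by (auto simp: ker_def)
    qed
    show "E \<subseteq> F"
    proof clarify
      fix x y assume "(x, y) \<in> E"
      then have "idx E x = idx E y" by (simp add: idx_eq_iff[OF iE])
      with main[of x] main[of y] show "(x, y) \<in> F"
        by (simp add: idx_eq_iff[OF iF, symmetric])
    qed
  qed
  then show ?thesis using R sub rj by blast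
qed

text \<open>Consecutive stages agree on longer and longer approximations, so their union still has
  infinitely many classes. As \<open>\<Psi> j\<close> may fail to pass to this limit, the conclusion
  returns for each \<open>j\<close> a stage that satisfies it.\<close>

lemma fusion:
  assumes A0: "A0 \<in> R" "\<Psi> k A0"
    and step: "\<And>j A. k \<le> j \<Longrightarrow> A \<in> R \<Longrightarrow> A0 \<subseteq> A \<Longrightarrow> r k A = r k A0 \<Longrightarrow> \<Psi> j A \<Longrightarrow>
      \<exists>A'\<in>R. A \<subseteq> A' \<and> r j A' = r j A \<and> \<Psi> (Suc j) A'"
  shows "\<exists>A\<in>R. A0 \<subseteq> A \<and> r k A = r k A0 \<and>
    (\<forall>j\<ge>k. \<exists>A'\<in>R. A0 \<subseteq> A' \<and> A' \<subseteq> A \<and> r j A = r j A' \<and> \<Psi> j A')"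
proof -
  define Q where "Q n A \<longleftrightarrow> A \<in> R \<and> A0 \<subseteq> A \<and> r k A = r k A0 \<and> \<Psi> (k + n) A" for n A
  have "\<exists>S. \<forall>n. Q n (S n) \<and> (S n \<subseteq> S (Suc n) \<and> r (k + n) (S (Suc n)) = r (k + n) (S n))"
  proof (rule dependent_nat_choice)
    show "\<exists>A. Q 0 A" using A0 by (auto simp: Q_def)
    fix A n assume "Q n A"
    then have A: "A \<in> R" "A0 \<subseteq> A" "r k A = r k A0" "\<Psi> (k + n) A" by (auto simp: Q_def)
    obtain A' where A': "A' \<in> R" "A \<subseteq> A'" "r (k + n) A' = r (k + n) A" "\<Psi> (Suc (k + n)) A'"
      using step[OF _ A] by auto
    moreover have "r k A' = r k A" by (rule R_r_mono[OF A(1) A'(1,3)]) simp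
    ultimately show "\<exists>A'. Q (Suc n) A' \<and> A \<subseteq> A' \<and> r (k + n) A' = r (k + n) A"
      using A by (intro exI[of _ A']) (auto simp: Q_def)
  qed
  then obtain S where "\<forall>n. Q n (S n) \<and> (S n \<subseteq> S (Suc n) \<and> r (k + n) (S (Suc n)) = r (k + n) (S n))" ..
  then have S: "\<And>n. Q n (S n)" "\<And>n. S n \<subseteq> S (Suc n)"
    "\<And>n. r (k + n) (S (Suc n)) = r (k + n) (S n)" by auto
  have SR: "S n \<in> R" for n using S(1) by (simp add: Q_def)
  note iS = R_inf_equiv[OF SR]
  have Smono: "S n \<subseteq> S N" if "n \<le> N" for n N
    by (rule lift_Suc_mono_le[of S, OF S(2) that])
  have Sr: "r (k + n) (S N) = r (k + n) (S n)" if "n \<le> N" for n N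
    using that
  proof (induction N rule: dec_induct)
    case (step N)
    have "r (k + n) (S (Suc N)) = r (k + n) (S N)"
      by (rule R_r_mono[OF SR SR S(3)]) (simp add: step(1))
    then show ?case using step by simp
  qed simp
  have Sp: "p t (S N) = p t (S n)" if "n \<le> N" "t \<le> k + n" for t n N
    by (rule R_r_p[OF SR SR Sr]) (use that in auto)
  \<comment> \<open>The stages from \<open>Suc x\<close> on share an approximation reaching beyond
    \<open>x\<close>, so the index of \<open>x\<close> no longer changes.\<close>
  define f where "f x = idx (S (Suc x)) x" for x
  define m where "m t = p t (S t)" for t
  have f: "f x = idx (S N) x" if "Suc x \<le> N" for x N
  proof -
    have "x < p (k + Suc x) (S (Suc x))"
      using le_p[OF iS, of "k + Suc x" "Suc x"] by simp
    then show ?thesis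
      unfolding f_def using r_eqD(3)[OF iS iS Sr[OF that, symmetric]] by simp
  qed
  have m: "p t (S N) = m t" if "t \<le> N" for t N
    unfolding m_def by (rule Sp[OF that]) simp
  have mono: "strict_mono m"
  proof (rule strict_mono_Suc_iff[THEN iffD2], rule allI)
    fix t show "m t < m (Suc t)"
      using m[of t "Suc t"] p_less_iff[OF iS, of t "Suc t" "Suc t"] by (simp add: m_def)
  qed
  have fm: "f (m t) = t" for t
    using f[of "m t" "max t (Suc (m t))"] m[of t "max t (Suc (m t))"] idx_p[OF iS] by (metis max.cobounded1 max.cobounded2)
  have mf: "m (f x) \<le> x" for x
    using f[of x "max (f x) (Suc x)"] m[of "f x" "max (f x) (Suc x)"] p_idx_le[OF iS]
    by (metis max.cobounded1 max.cobounded2)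
  define L where "L = ker f"
  have L: "L \<in> R"
    unfolding L_def
  proof (rule ker_in_R[OF mono fm mf])
    show "col (m t) = c t" for t by (simp add: m_def R_col[OF SR])
    show "col x \<in> I (c (f x))" for x by (simp add: f_def R_class[OF SR])
  qed
  have SL: "S n \<subseteq> L" for n
  proof clarify
    fix x y assume xy: "(x, y) \<in> S n"
    define N where "N = max n (Suc (max x y))"
    have "(x, y) \<in> S N" using xy Smono[of n N] by (auto simp: N_def)
    then have "idx (S N) x = idx (S N) y" by (simp add: idx_eq_iff[OF iS])
    moreover have "f x = idx (S N) x" "f y = idx (S N) y"
      by (rule f, simp add: N_def)+
    ultimately show "(x, y) \<in> L" by (simp add: L_def ker_def)
  qed
  have rL: "r (k + n) L = r (k + n) (S n)" for n
  proof (rule R_r_eqI[OF SR L SL])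
    have "p (k + n) L = m (k + n)" unfolding L_def by (rule p_ker[OF mono fm mf])
    also have "\<dots> = p (k + n) (S n)" unfolding m_def by (rule Sp) auto
    finally show "p (k + n) L = p (k + n) (S n)" .
  qed
  have "\<exists>A'\<in>R. A0 \<subseteq> A' \<and> A' \<subseteq> L \<and> r j L = r j A' \<and> \<Psi> j A'" if "j \<ge> k" for j
    using S(1)[of "j - k"] rL[of "j - k"] SL that by (auto simp: Q_def intro!: bexI[of _ "S (j - k)"])
  moreover have "A0 \<subseteq> L" "r k L = r k A0"
    using S(1)[of 0] SL[of 0] rL[of 0] by (auto simp: Q_def)
  ultimately show ?thesis using L by blast
qed

section \<open>The dichotomy between rigid and absorbing relations\<close>

definition good :: "nat \<Rightarrow> eqrel \<Rightarrow> bool" where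
  "good K A \<longleftrightarrow> (\<forall>s. \<exists>i\<le>K. \<forall>x. idx A x = s \<longrightarrow> col x \<in> I (c i))"

lemma good_mono: "good K A \<Longrightarrow> K \<le> K' \<Longrightarrow> good K' A"
  unfolding good_def by (meson order_trans)

text \<open>Some class \<open>s\<close> of \<open>A\<close> fits into none of the first
  \<open>K + 1\<close> classes, so in every coarsening it lies in a class of larger index, whose
  minimum is at most \<open>p s A\<close>.\<close>

lemma not_good_bounded:
  assumes A: "A \<in> R" and "\<not> good K A"
  shows "\<exists>b. \<forall>E\<in>R. A \<subseteq> E \<longrightarrow> p (Suc K) E \<le> b"
proof -
  obtain s where s: "\<And>i. i \<le> K \<Longrightarrow> \<exists>x. idx A x = s \<and> col x \<notin> I (c i)"
    using assms(2) by (auto simp: good_def)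
  have "p (Suc K) E \<le> p s A" if E: "E \<in> R" "A \<subseteq> E" for E
  proof -
    define t where "t = idx E (p s A)"
    have "\<not> t \<le> K"
    proof
      assume "t \<le> K"
      then obtain x where x: "idx A x = s" "col x \<notin> I (c t)" using s by blast
      have "(x, p s A) \<in> E"
        using rel_p_idx[OF R_inf_equiv[OF A], of x] x E by auto
      then have "idx E x = t" by (simp add: t_def idx_eq_iff R_inf_equiv E)
      then show False using R_class[OF E(1), of x] x by simp
    qed
    then have "p (Suc K) E \<le> p t E" by (simp add: p_le_iff R_inf_equiv E)
    also have "\<dots> \<le> p s A" unfolding t_def by (rule p_idx_le[OF R_inf_equiv[OF E(1)]])
    finally show ?thesis .
  qed
  then show ?thesis by blast
qed

text \<open>Either the space collapses to a point below some \<open>A\<close>, or every class can be absorbed into one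
  of the first \<open>K + 1\<close> classes; otherwise successive maximisation of \<open>p (Suc K)\<close>
  would yield such an \<open>A\<close> by fusion.\<close>

lemma rigid_or_good:
  assumes A0: "A0 \<in> R"
  shows "(\<exists>A\<in>R. A0 \<subseteq> A \<and> r k A = r k A0 \<and> (\<forall>E\<in>R. A \<subseteq> E \<and> r k E = r k A \<longrightarrow> E = A)) \<or>
    (\<exists>A\<in>R. \<exists>K\<ge>k. A0 \<subseteq> A \<and> r k A = r k A0 \<and>
       (\<forall>E\<in>R. A \<subseteq> E \<and> r k E = r k A \<longrightarrow> p K E = p K A \<and> good K E))"
proof (rule disjCI)
  assume not_good: "\<not> (\<exists>A\<in>R. \<exists>K\<ge>k. A0 \<subseteq> A \<and> r k A = r k A0 \<and>
       (\<forall>E\<in>R. A \<subseteq> E \<and> r k E = r k A \<longrightarrow> p K E = p K A \<and> good K E))"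
  define \<Psi> where "\<Psi> j A \<longleftrightarrow> (\<forall>E\<in>R. A \<subseteq> E \<and> r k E = r k A \<longrightarrow> p j E = p j A)" for j A
  have "\<exists>A\<in>R. A0 \<subseteq> A \<and> r k A = r k A0 \<and>
    (\<forall>j\<ge>k. \<exists>A'\<in>R. A0 \<subseteq> A' \<and> A' \<subseteq> A \<and> r j A = r j A' \<and> \<Psi> j A')"
  proof (rule fusion[OF A0])
    show "\<Psi> k A0" using R_r_p[OF A0] by (auto simp: \<Psi>_def)
    fix j A assume j: "k \<le> j" and A: "A \<in> R" "A0 \<subseteq> A" "r k A = r k A0" and \<Psi>: "\<Psi> j A"
    obtain E where E: "E \<in> R" "A \<subseteq> E" "r k E = r k A" "\<not> good j E"
      using not_good j A \<Psi> unfolding \<Psi>_def by metis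
    obtain b where b: "\<And>F. F \<in> R \<Longrightarrow> E \<subseteq> F \<Longrightarrow> p (Suc j) F \<le> b"
      using not_good_bounded[OF E(1,4)] by blast
    \<comment> \<open>Coarsening can only raise \<open>p (Suc j)\<close>, which is bounded here. A
      maximiser therefore freezes this value for all further coarsenings that keep
      \<open>r k\<close>.\<close>
    have "\<exists>F. (F \<in> R \<and> E \<subseteq> F \<and> r k F = r k E) \<and>
      (\<forall>G. G \<in> R \<and> E \<subseteq> G \<and> r k G = r k E \<longrightarrow> p (Suc j) G \<le> p (Suc j) F)"
      by (rule ex_has_greatest_nat[of _ E _ "Suc b"]) (use E b in \<open>auto simp: less_Suc_eq_le\<close>)
    then obtain F where F: "F \<in> R" "E \<subseteq> F" "r k F = r k E"
      and max: "\<And>G. G \<in> R \<Longrightarrow> E \<subseteq> G \<Longrightarrow> r k G = r k E \<Longrightarrow> p (Suc j) G \<le> p (Suc j) F" by auto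
    have AF: "A \<subseteq> F" "r k F = r k A" using E(2,3) F(2,3) by (blast, simp)
    have "p j F = p j A"
      using \<Psi> F(1) AF unfolding \<Psi>_def by blast
    with A(1) F(1) AF(1) have "r j F = r j A"
      by (rule R_r_eqI)
    moreover have "\<Psi> (Suc j) F"
      unfolding \<Psi>_def
    proof (intro ballI impI)
      fix G assume G: "G \<in> R" "F \<subseteq> G \<and> r k G = r k F"
      have "E \<subseteq> G" using G(2) F(2) by (meson order_trans)
      moreover have "r k G = r k E" using G(2) F(3) by (elim conjE) (rule trans)
      ultimately have "p (Suc j) G \<le> p (Suc j) F" by (rule max[OF G(1)])
      moreover have "p (Suc j) F \<le> p (Suc j) G"
        using coarser_p_le[OF R_inf_equiv[OF F(1)] R_inf_equiv[OF G(1)]] G(2) by (elim conjE)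
      ultimately show "p (Suc j) G = p (Suc j) F" by (rule antisym)
    qed
    ultimately show "\<exists>A'\<in>R. A \<subseteq> A' \<and> r j A' = r j A \<and> \<Psi> (Suc j) A'"
      using F(1) AF(1) by blast
  qed
  then obtain A where A: "A \<in> R" "A0 \<subseteq> A" "r k A = r k A0"
    and \<Psi>: "\<And>j. j \<ge> k \<Longrightarrow> \<exists>A'\<in>R. A0 \<subseteq> A' \<and> A' \<subseteq> A \<and> r j A = r j A' \<and> \<Psi> j A'" by auto
  \<comment> \<open>All values \<open>p j\<close> with j \<ge> k are now frozen, so a coarsening
    agrees with \<open>A\<close> on arbitrarily long approximations.\<close>
  have "E = A" if E: "E \<in> R" "A \<subseteq> E" "r k E = r k A" for E
  proof
    have req: "r j E = r j A" if j: "j \<ge> k" for j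
    proof -
      obtain A' where A': "A' \<in> R" "A' \<subseteq> A" "r j A = r j A'" "\<Psi> j A'"
        using \<Psi>[OF j] by blast
      have "r k A = r k A'" by (rule R_r_mono[OF A'(1) A(1) A'(3) j])
      then have "p j E = p j A'" "p j A = p j A'"
        using A'(2,4) A E by (auto simp: \<Psi>_def)
      then show ?thesis by (intro R_r_eqI) (use A E in auto)
    qed
    show "E \<subseteq> A"
    proof clarify
      fix x y assume xy: "(x, y) \<in> E"
      define j where "j = max k (Suc (max x y))"
      have "x < p j E" "y < p j E"
        using le_p[OF R_inf_equiv[OF E(1)], of j] by (auto simp: j_def)
      then have "(x, y) \<in> r j E" using xy by (simp add: r_def)
      then show "(x, y) \<in> A" using req[of j] by (auto simp: j_def r_def)
    qed
  qed (rule E)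
  then show "\<exists>A\<in>R. A0 \<subseteq> A \<and> r k A = r k A0 \<and> (\<forall>E\<in>R. A \<subseteq> E \<and> r k E = r k A \<longrightarrow> E = A)"
    using A by blast
qed

end

section \<open>Words with restricted letters\<close>

text \<open>Words are partial maps rather than lists because the letters allowed depend on the
  absolute position. The total operation \<open>++\<close> is concatenation once the right word
  starts after the left one, and the filters \<open>W\<close> and \<open>F n\<close> ensure this for
  almost all right factors.\<close>

type_synonym word = "nat \<rightharpoonup> nat"

interpretation word: semigroup "(++) :: word \<Rightarrow> word \<Rightarrow> word"
  by unfold_locales simp

text \<open>Letters \<open>a \<le> k\<close> are constants, larger ones are variables; \<open>\<Lambda> s\<close> are the constants allowed at
  position \<open>s\<close>. Variables of kind \<open>n\<close> live on \<open>T n\<close>, where \<open>S n\<close> is the set of allowed constants.\<close>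

locale restricted_words =
  fixes k :: nat and \<Lambda> T S :: "nat \<Rightarrow> nat set"
  assumes \<Lambda>_le: "a \<in> \<Lambda> s \<Longrightarrow> a \<le> k" and \<Lambda>_ne: "\<Lambda> s \<noteq> {}"
    and T_inf: "infinite (T n)" and \<Lambda>_T: "s \<in> T n \<Longrightarrow> \<Lambda> s = S n"
begin

definition const_words :: "nat \<Rightarrow> word set" where
  "const_words N = {t. finite (dom t) \<and> dom t \<subseteq> {N<..} \<and> (\<forall>s a. t s = Some a \<longrightarrow> a \<in> \<Lambda> s)}"

definition var_words :: "nat \<Rightarrow> nat \<Rightarrow> word set" where
  "var_words n N = {t. finite (dom t) \<and> dom t \<subseteq> {N<..} \<and> dom t \<noteq> {} \<and> t (Min (dom t)) = Some (Suc k) \<and>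
     (\<forall>s a. t s = Some a \<longrightarrow> a \<in> \<Lambda> s \<or> a = Suc k \<and> s \<in> T n)}"

definition W :: "word filter" where
  "W = (INF N. principal (const_words N))"

definition F :: "nat \<Rightarrow> word filter" where
  "F n = (INF N. principal (var_words n N))"

definition sub :: "nat \<Rightarrow> word \<Rightarrow> word" where
  "sub a t = map_option (\<lambda>x. if x \<le> k then x else a) \<circ> t"

lemma eventually_W: "eventually P W \<longleftrightarrow> (\<exists>N. \<forall>t\<in>const_words N. P t)"
proof -
  have "eventually P W \<longleftrightarrow> (\<exists>N\<in>UNIV. eventually P (principal (const_words N)))"
    unfolding W_def
  proof (rule eventually_INF_base)
    fix M N :: nat
    have "const_words (max M N) \<subseteq> const_words M \<inter> const_words N"
      by (fastforce simp: const_words_def)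
    then show "\<exists>x\<in>UNIV. principal (const_words x) \<le> inf (principal (const_words M)) (principal (const_words N))"
      by auto
  qed simp
  then show ?thesis by (simp add: eventually_principal)
qed

lemma eventually_F: "eventually P (F n) \<longleftrightarrow> (\<exists>N. \<forall>t\<in>var_words n N. P t)"
proof -
  have "eventually P (F n) \<longleftrightarrow> (\<exists>N\<in>UNIV. eventually P (principal (var_words n N)))"
    unfolding F_def
  proof (rule eventually_INF_base)
    fix M N :: nat
    have "var_words n (max M N) \<subseteq> var_words n M \<inter> var_words n N"
      by (fastforce simp: var_words_def)
    then show "\<exists>x\<in>UNIV. principal (var_words n x) \<le> inf (principal (var_words n M)) (principal (var_words n N))"
      by auto
  qed simp
  then show ?thesis by (simp add: eventually_principal)
qed

lemma const_words_add: "s \<in> const_words N \<Longrightarrow> t \<in> const_words N \<Longrightarrow> s ++ t \<in> const_words N"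
  by (auto simp: const_words_def map_add_Some_iff)

lemma var_words_add:
  assumes s: "s \<in> var_words n N"
    and t: "finite (dom t)" "dom t \<subseteq> {max N (Max (dom s))<..}"
      "\<And>x a. t x = Some a \<Longrightarrow> a \<in> \<Lambda> x \<or> a = Suc k \<and> x \<in> T n"
  shows "s ++ t \<in> var_words n N"
proof -
  have fin: "finite (dom s)" "dom s \<noteq> {}" using s by (auto simp: var_words_def)
  have "Min (dom (s ++ t)) = Min (dom s)"
  proof (rule Min_eqI)
    show "Min (dom s) \<in> dom (s ++ t)" using fin Min_in[of "dom s"] by simp
    fix y assume "y \<in> dom (s ++ t)"
    then consider "y \<in> dom t" | "y \<in> dom s" by auto
    then show "Min (dom s) \<le> y"
    proof cases
      case 1
      then have "Max (dom s) < y" using t by auto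
      moreover have "Min (dom s) \<le> Max (dom s)" using fin by simp
      ultimately show ?thesis by simp
    qed (use fin in simp)
  qed (use fin t in auto)
  moreover have "Min (dom s) \<notin> dom t"
    using t(2) fin Min_in[of "dom s"] Max_ge[of "dom s"] by fastforce
  ultimately have "(s ++ t) (Min (dom (s ++ t))) = Some (Suc k)"
    using s by (simp add: var_words_def map_add_dom_app_simps)
  moreover have "dom (s ++ t) \<subseteq> {N<..}" using s t(2) by (auto simp: var_words_def)
  moreover have "a \<in> \<Lambda> x \<or> a = Suc k \<and> x \<in> T n" if "(s ++ t) x = Some a" for x a
    using that s t(3)[of x a] by (auto simp: var_words_def map_add_Some_iff)
  ultimately show ?thesis using fin t(1) by (simp add: var_words_def)
qed

lemma sub_add: "sub a (s ++ t) = sub a s ++ sub a t"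
  by (auto simp: sub_def map_add_def fun_eq_iff split: option.split)

lemma sub_const_words: "t \<in> const_words N \<Longrightarrow> sub a t = t"
  by (rule ext, case_tac "t x") (auto simp: sub_def const_words_def dest: \<Lambda>_le)

lemma dom_sub: "dom (sub a t) = dom t"
  by (auto simp: sub_def dom_def)

lemma sub_var_words:
  assumes "t \<in> var_words n N" "a \<in> S n"
  shows "sub a t \<in> const_words N"
proof -
  have "b \<in> \<Lambda> s" if "sub a t s = Some b" for s b
  proof -
    obtain x where x: "t s = Some x" "b = (if x \<le> k then x else a)"
      using \<open>sub a t s = Some b\<close> by (auto simp: sub_def)
    have "x \<in> \<Lambda> s \<or> x = Suc k \<and> s \<in> T n"
      using assms(1) x(1) by (simp add: var_words_def)
    then show ?thesis
    proof
      assume "x \<in> \<Lambda> s"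
      then show ?thesis using x(2) \<Lambda>_le[of x s] by simp
    next
      assume "x = Suc k \<and> s \<in> T n"
      then show ?thesis using x(2) \<Lambda>_T[of s n] assms(2) by simp
    qed
  qed
  then show ?thesis using assms(1) by (auto simp: const_words_def var_words_def dom_sub)
qed

lemma W_facts: "W \<noteq> bot" "word.conv W W \<le> W"
proof -
  have "Map.empty \<in> const_words N" for N by (simp add: const_words_def)
  then show "W \<noteq> bot" unfolding trivial_limit_def eventually_W by blast
  show "word.conv W W \<le> W"
    by (rule filter_leI) (unfold eventually_W word.eventually_conv, blast intro: const_words_add)
qed

lemma F_facts: "F n \<noteq> bot" "word.conv (F n) (F n) \<le> F n" "word.conv (F n) W \<le> F n"
proof -
  have "\<exists>t. t \<in> var_words n N" for N
  proof -
    obtain s where s: "s \<in> T n" "N < s"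
      using T_inf[of n] by (auto simp: infinite_nat_iff_unbounded)
    have "[s \<mapsto> Suc k] \<in> var_words n N" using s by (simp add: var_words_def)
    then show ?thesis by (intro exI[of _ "[s \<mapsto> Suc k]"])
  qed
  then show "F n \<noteq> bot" unfolding trivial_limit_def eventually_F by blast
  show "word.conv (F n) (F n) \<le> F n"
  proof (rule filter_leI)
    fix P assume "eventually P (F n)"
    then obtain N where N: "\<And>t. t \<in> var_words n N \<Longrightarrow> P t" by (auto simp: eventually_F)
    have "P (s ++ t)" if "s \<in> var_words n N" "t \<in> var_words n (max N (Max (dom s)))" for s t
      by (rule N, rule var_words_add) (use that in \<open>auto simp: var_words_def\<close>)
    then show "eventually P (word.conv (F n) (F n))"
      unfolding eventually_F word.eventually_conv by blast
  qed
  show "word.conv (F n) W \<le> F n"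
  proof (rule filter_leI)
    fix P assume "eventually P (F n)"
    then obtain N where N: "\<And>t. t \<in> var_words n N \<Longrightarrow> P t" by (auto simp: eventually_F)
    have "P (s ++ t)" if "s \<in> var_words n N" "t \<in> const_words (max N (Max (dom s)))" for s t
      by (rule N, rule var_words_add) (use that in \<open>auto simp: var_words_def const_words_def\<close>)
    then show "eventually P (word.conv (F n) W)"
      unfolding eventually_F eventually_W word.eventually_conv by blast
  qed
qed

lemma word_ultrafilters:
  obtains U V where "ultra U" "U \<le> W" "word.conv U U = U"
    "\<And>n. ultra (V n)" "\<And>n. V n \<le> F n" "\<And>n a. a \<in> S n \<Longrightarrow> word.conv U (filtermap (sub a) (V n)) = U"
proof (rule word.absorbing_ultrafilters[of W F "\<lambda>n. sub ` S n"])
  fix n h assume "h \<in> sub ` S n"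
  then obtain a where h: "h = sub a" "a \<in> S n" by blast
  show "h (s ++ t) = h s ++ h t" for s t by (simp add: h sub_add)
  show "filtermap h (F n) \<le> W"
    by (rule filter_leI) (unfold eventually_filtermap eventually_F eventually_W h(1), blast intro: sub_var_words h(2))
  show "eventually (\<lambda>t. h t = t) W"
    unfolding eventually_W h by (blast intro: sub_const_words)
next
  fix U V
  assume "ultra U" "U \<le> W" "word.conv U U = U" "\<And>n. ultra (V n)" "\<And>n. V n \<le> F n"
    and "\<And>n h. h \<in> sub ` S n \<Longrightarrow> word.conv U (filtermap h (V n)) = U"
  then show thesis by (intro that[of U V]) auto
qed (rule W_facts F_facts)+

section \<open>Construction of a homogeneous word\<close>

definition fill :: "(nat \<Rightarrow> nat) \<Rightarrow> word \<Rightarrow> nat \<Rightarrow> nat" where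
  "fill \<delta> t s = (case t s of None \<Rightarrow> \<delta> s | Some a \<Rightarrow> a)"

definition inst :: "(nat \<Rightarrow> nat) \<Rightarrow> nat \<Rightarrow> nat" where
  "inst \<sigma> a = (if a \<le> k then a else \<sigma> (a - Suc k))"

text \<open>The form of the Carlson--Simpson theorem for left-variable words needed here. In the infinite
  word \<open>h\<close> the \<open>l\<close>-th variable is the letter \<open>Suc k + l\<close>, with first occurrence \<open>\<mu> l\<close>; the colour
  \<open>\<phi> f q\<close> is meant to depend only on \<open>f\<close> between \<open>j\<close> and \<open>q\<close>.\<close>

definition homogeneous_word ::
    "nat \<Rightarrow> (nat \<Rightarrow> nat) \<Rightarrow> nat \<Rightarrow> ((nat \<Rightarrow> nat) \<Rightarrow> nat \<Rightarrow> bool) \<Rightarrow> (nat \<Rightarrow> nat) \<Rightarrow> (nat \<Rightarrow> nat) \<Rightarrow> bool \<Rightarrow> bool"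
  where
  "homogeneous_word j \<nu> D \<phi> h \<mu> b \<longleftrightarrow>
    (\<forall>l>j. j < \<mu> l \<and> \<mu> l < \<mu> (Suc l) \<and> h (\<mu> l) = Suc k + l \<and> \<mu> l \<in> T (\<nu> l)) \<and>
    (\<forall>s>j. h s \<in> \<Lambda> s \<or> (\<exists>l>j. h s = Suc k + l \<and> \<mu> l \<le> s \<and> s \<in> T (\<nu> l))) \<and>
    (\<forall>l>j. \<nu> l = D \<longrightarrow> (\<forall>\<sigma>. (\<forall>l'. j < l' \<and> l' < l \<longrightarrow> \<sigma> l' \<in> S (\<nu> l')) \<longrightarrow>
       \<phi> (\<lambda>s. inst \<sigma> (h s)) (\<mu> l) = b))"

lemma S_le: "a \<in> S n \<Longrightarrow> a \<le> k"
proof -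
  assume a: "a \<in> S n"
  obtain s where "s \<in> T n" using T_inf[of n] by (metis finite.emptyI ex_in_conv)
  then show "a \<le> k" using a \<Lambda>_T \<Lambda>_le by metis
qed

definition assign :: "(nat \<Rightarrow> nat) \<Rightarrow> word \<Rightarrow> word" where
  "assign \<sigma> t = map_option (inst \<sigma>) \<circ> t"

lemma assign_add: "assign \<sigma> (s ++ t) = assign \<sigma> s ++ assign \<sigma> t"
  by (auto simp: assign_def map_add_def fun_eq_iff split: option.split)

lemma assign_const_words: "t \<in> const_words N \<Longrightarrow> assign \<sigma> t = t"
  by (rule ext, case_tac "t x") (auto simp: assign_def inst_def const_words_def dest: \<Lambda>_le)

lemma assign_sub: "assign \<sigma> (sub (Suc k + l) t) = sub (\<sigma> l) t"
  by (auto simp: assign_def sub_def inst_def fun_eq_iff map_option.compositionality o_def intro: map_option_cong)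

text \<open>The starred set from the Galvin-Glazer proof of Hindman's theorem: for idempotent
  \<open>U\<close> and \<open>U\<close>-large \<open>G\<close> it is again \<open>U\<close>-large,
  and its members remain in it after appending \<open>U\<close>-almost any word.\<close>

definition extendable :: "word filter \<Rightarrow> (word \<Rightarrow> bool) \<Rightarrow> word \<Rightarrow> bool" where
  "extendable U G t \<longleftrightarrow> G t \<and> eventually (\<lambda>u. G (t ++ u)) U"

lemma eventually_extendable:
  assumes U: "word.conv U U = U"
  shows "eventually G U \<Longrightarrow> eventually (extendable U G) U"
    and "extendable U G t \<Longrightarrow> eventually (\<lambda>u. extendable U G (t ++ u)) U"
proof -
  assume G: "eventually G U"
  then have "eventually (\<lambda>t. eventually (\<lambda>u. G (t ++ u)) U) U"
    using U by (metis word.eventually_conv)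
  with G show "eventually (extendable U G) U"
    unfolding extendable_def by (rule eventually_conj)
next
  assume "extendable U G t"
  then have G: "eventually (\<lambda>u. G (t ++ u)) U" by (simp add: extendable_def)
  then have "eventually (\<lambda>u. eventually (\<lambda>u'. G (t ++ (u ++ u'))) U) U"
    by (subst word.eventually_conv[symmetric]) (simp add: U)
  with G show "eventually (\<lambda>u. extendable U G (t ++ u)) U"
    unfolding extendable_def by eventually_elim simp
qed

text \<open>One step of the construction of a homogeneous word: append constants \<open>x\<close> to the current block,
  start a new block with the left-variable word \<open>v\<close>, and append constants \<open>u\<close>.\<close>

lemma extension_step:
  assumes U: "ultra U" "U \<le> W" "word.conv U U = U"
    and V: "ultra V" "V \<le> F n" "\<And>a. a \<in> S n \<Longrightarrow> word.conv U (filtermap (sub a) V) = U"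
    and fin: "finite FF" "\<And>f. f \<in> FF \<Longrightarrow> extendable U G f"
    and G: "\<And>t. Q \<Longrightarrow> G t \<Longrightarrow> eventually (\<lambda>v. \<psi> t (Min (dom v))) V"
  obtains x v u where "x \<in> const_words N" "v \<in> var_words n (Max (insert N (dom x)))"
    "u \<in> const_words (Max (insert N (dom x \<union> dom v)))"
    "\<And>f. f \<in> FF \<Longrightarrow> Q \<Longrightarrow> \<psi> (f ++ x) (Min (dom v))"
    "\<And>f a. f \<in> FF \<Longrightarrow> a \<in> S n \<Longrightarrow> extendable U G (f ++ x ++ sub a v ++ u)"
proof -
  have Ub: "U \<noteq> bot" and Vb: "V \<noteq> bot" using U V by (auto simp: ultra_def)
  have finS: "finite (S n)" using S_le by (meson atMost_iff finite_atMost finite_subset subsetI)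
  have "\<forall>\<^sub>F x in U. \<forall>\<^sub>F v in V. \<forall>\<^sub>F u in U. extendable U G (f ++ x ++ sub a v ++ u)"
    if "f \<in> FF" "a \<in> S n" for f a
  proof -
    have "eventually (\<lambda>u. extendable U G (f ++ u)) U"
      by (rule eventually_extendable(2)[OF U(3) fin(2)[OF that(1)]])
    \<comment> \<open>Absorption and idempotence write \<open>U\<close> as the product of
      \<open>U\<close>, the instance of \<open>V\<close> at \<open>a\<close>, and \<open>U\<close>.
      A statement on almost all appended words thus splits into one on \<open>x\<close>, then
      \<open>v\<close>, then \<open>u\<close>.\<close>
    then have "eventually (\<lambda>u. extendable U G (f ++ u)) (word.conv U (word.conv (filtermap (sub a) V) U))"
      using V(3)[OF that(2)] U(3) by (simp flip: word.conv_assoc)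
    then show ?thesis by (simp add: word.eventually_conv eventually_filtermap)
  qed
  then have "\<forall>\<^sub>F x in U. \<forall>f\<in>FF. \<forall>a\<in>S n. \<forall>\<^sub>F v in V. \<forall>\<^sub>F u in U. extendable U G (f ++ x ++ sub a v ++ u)"
    by (intro eventually_ball_finite ballI fin finS)
  moreover have "\<forall>\<^sub>F x in U. \<forall>f\<in>FF. extendable U G (f ++ x)"
    by (intro eventually_ball_finite ballI fin eventually_extendable(2)[OF U(3)])
  moreover have "\<forall>\<^sub>F x in U. x \<in> const_words N"
    by (rule filter_leD[OF U(2)]) (auto simp: eventually_W)
  ultimately have "\<forall>\<^sub>F x in U. x \<in> const_words N \<and> (\<forall>f\<in>FF. extendable U G (f ++ x)) \<and>
      (\<forall>f\<in>FF. \<forall>a\<in>S n. \<forall>\<^sub>F v in V. \<forall>\<^sub>F u in U. extendable U G (f ++ x ++ sub a v ++ u))"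
    by eventually_elim blast
  then obtain x where x: "x \<in> const_words N" "\<forall>f\<in>FF. extendable U G (f ++ x)"
    "\<forall>f\<in>FF. \<forall>a\<in>S n. \<forall>\<^sub>F v in V. \<forall>\<^sub>F u in U. extendable U G (f ++ x ++ sub a v ++ u)"
    using eventually_happens'[OF Ub] by blast
  have "\<forall>\<^sub>F v in V. \<forall>f\<in>FF. \<forall>a\<in>S n. \<forall>\<^sub>F u in U. extendable U G (f ++ x ++ sub a v ++ u)"
    using x(3) by (intro eventually_ball_finite ballI fin finS) blast
  moreover have "\<forall>\<^sub>F v in V. \<forall>f\<in>FF. Q \<longrightarrow> \<psi> (f ++ x) (Min (dom v))"
  proof (intro eventually_ball_finite ballI fin)
    fix f assume "f \<in> FF"
    then have "Q \<Longrightarrow> eventually (\<lambda>v. \<psi> (f ++ x) (Min (dom v))) V"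
      using x(2) G by (auto simp: extendable_def)
    then show "eventually (\<lambda>v. Q \<longrightarrow> \<psi> (f ++ x) (Min (dom v))) V" by (cases Q) auto
  qed
  moreover have "\<forall>\<^sub>F v in V. v \<in> var_words n (Max (insert N (dom x)))"
    by (rule filter_leD[OF V(2)]) (auto simp: eventually_F)
  ultimately have "\<forall>\<^sub>F v in V. v \<in> var_words n (Max (insert N (dom x))) \<and>
      (\<forall>f\<in>FF. Q \<longrightarrow> \<psi> (f ++ x) (Min (dom v))) \<and>
      (\<forall>f\<in>FF. \<forall>a\<in>S n. \<forall>\<^sub>F u in U. extendable U G (f ++ x ++ sub a v ++ u))"
    by eventually_elim blast
  then obtain v where v: "v \<in> var_words n (Max (insert N (dom x)))"
    "\<forall>f\<in>FF. Q \<longrightarrow> \<psi> (f ++ x) (Min (dom v))"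
    "\<forall>f\<in>FF. \<forall>a\<in>S n. \<forall>\<^sub>F u in U. extendable U G (f ++ x ++ sub a v ++ u)"
    using eventually_happens'[OF Vb] by blast
  have "\<forall>\<^sub>F u in U. \<forall>f\<in>FF. \<forall>a\<in>S n. extendable U G (f ++ x ++ sub a v ++ u)"
    using v(3) by (intro eventually_ball_finite ballI fin finS) blast
  moreover have "\<forall>\<^sub>F u in U. u \<in> const_words (Max (insert N (dom x \<union> dom v)))"
    by (rule filter_leD[OF U(2)]) (auto simp: eventually_W)
  ultimately have "\<forall>\<^sub>F u in U. u \<in> const_words (Max (insert N (dom x \<union> dom v))) \<and>
      (\<forall>f\<in>FF. \<forall>a\<in>S n. extendable U G (f ++ x ++ sub a v ++ u))"
    by eventually_elim blast
  then obtain u where "u \<in> const_words (Max (insert N (dom x \<union> dom v)))"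
      "\<forall>f\<in>FF. \<forall>a\<in>S n. extendable U G (f ++ x ++ sub a v ++ u)"
    using eventually_happens'[OF Ub] by blast
  then show thesis using that x(1) v(1,2) by blast
qed

text \<open>After \<open>i\<close> steps the variables \<open>j + 1\<close> to \<open>j + i\<close>
  exist. The numbering starts after \<open>j\<close> because variable \<open>l\<close> becomes class
  \<open>l\<close> of the relation built in \<open>pigeonhole\<close>, whose classes
  \<open>0\<close> to \<open>j\<close> start where those of \<open>A\<close> do.\<close>

definition admissible :: "nat \<Rightarrow> (nat \<Rightarrow> nat) \<Rightarrow> nat \<Rightarrow> (nat \<Rightarrow> nat) \<Rightarrow> bool" where
  "admissible j \<nu> i \<sigma> \<longleftrightarrow> (\<forall>l. j < l \<and> l \<le> j + i \<longrightarrow> \<sigma> l \<in> S (\<nu> l))"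

definition stage :: "nat \<Rightarrow> (nat \<Rightarrow> nat) \<Rightarrow> (word \<Rightarrow> bool) \<Rightarrow> nat \<Rightarrow> word \<Rightarrow> bool" where
  "stage j \<nu> P i g \<longleftrightarrow> finite (dom g) \<and> dom g \<subseteq> {j<..} \<and>
    (\<forall>s a. g s = Some a \<longrightarrow> a \<in> \<Lambda> s \<or> (\<exists>l. j < l \<and> l \<le> j + i \<and> a = Suc k + l \<and> s \<in> T (\<nu> l))) \<and>
    (\<forall>\<sigma>. admissible j \<nu> i \<sigma> \<longrightarrow> P (assign \<sigma> g))"

definition next_stage :: "nat \<Rightarrow> (nat \<Rightarrow> nat) \<Rightarrow> (word \<Rightarrow> nat \<Rightarrow> bool) \<Rightarrow> nat \<Rightarrow> nat \<Rightarrow> word \<Rightarrow> word \<Rightarrow> nat \<Rightarrow> bool" where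
  "next_stage j \<nu> \<psi> D i g g' \<mu> \<longleftrightarrow> (let l = Suc (j + i) in
    (\<forall>s\<in>dom g. s < \<mu>) \<and> (\<forall>s\<in>dom g. g' s = g s) \<and>
    (\<forall>s\<in>dom g' - dom g. \<forall>s'\<in>dom g. s' < s) \<and>
    j < \<mu> \<and> \<mu> \<in> T (\<nu> l) \<and> g' \<mu> = Some (Suc k + l) \<and>
    (\<forall>s a. s \<notin> dom g \<longrightarrow> g' s = Some a \<longrightarrow> a \<in> \<Lambda> s \<or> a = Suc k + l \<and> \<mu> \<le> s) \<and>
    (\<nu> l = D \<longrightarrow> (\<forall>\<sigma>. admissible j \<nu> i \<sigma> \<longrightarrow> \<psi> (assign \<sigma> (g' |` {..<\<mu>})) \<mu>)))"

lemma dom_assign: "dom (assign \<sigma> t) = dom t"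
  by (auto simp: assign_def dom_def)

text \<open>There may be infinitely many assignments, but their values on the finite word
  \<open>g\<close> are letters at most \<open>k\<close>. Finiteness lets an ultrafilter treat all
  instances at once.\<close>

lemma finite_assignments:
  assumes "stage j \<nu> P i g"
  shows "finite {assign \<sigma> g |\<sigma>. admissible j \<nu> i \<sigma>}"
proof (rule finite_subset)
  show "finite {m. dom m = dom g \<and> ran m \<subseteq> {..k}}"
    by (rule finite_set_of_finite_maps) (use assms in \<open>auto simp: stage_def\<close>)
  show "{assign \<sigma> g |\<sigma>. admissible j \<nu> i \<sigma>} \<subseteq> {m. dom m = dom g \<and> ran m \<subseteq> {..k}}"
  proof clarify
    fix \<sigma> assume \<sigma>: "admissible j \<nu> i \<sigma>"
    have "inst \<sigma> a \<le> k" if a: "g s = Some a" for s a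
    proof -
      consider "a \<in> \<Lambda> s" | l where "j < l" "l \<le> j + i" "a = Suc k + l"
        using assms a unfolding stage_def by blast
      then show ?thesis
      proof cases
        case 2
        then have "\<sigma> l \<in> S (\<nu> l)" using \<sigma> by (simp add: admissible_def)
        then show ?thesis using 2 S_le by (simp add: inst_def)
      qed (simp add: inst_def \<Lambda>_le)
    qed
    then show "dom (assign \<sigma> g) = dom g \<and> ran (assign \<sigma> g) \<subseteq> {..k}"
      by (auto simp: dom_assign ran_def assign_def)
  qed
qed

lemma next_stage_exists:
  assumes U: "ultra U" "U \<le> W" "word.conv U U = U"
    and V: "ultra V" "V \<le> F n" "\<And>a. a \<in> S n \<Longrightarrow> word.conv U (filtermap (sub a) V) = U"
    and n: "n = \<nu> (Suc (j + i))"
    and G: "\<And>t. n = D \<Longrightarrow> G t \<Longrightarrow> eventually (\<lambda>v. \<psi> t (Min (dom v))) V"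
    and g: "stage j \<nu> (extendable U G) i g"
  obtains g' \<mu> where "stage j \<nu> (extendable U G) (Suc i) g'" "next_stage j \<nu> \<psi> D i g g' \<mu>"
proof -
  define l where "l = Suc (j + i)"
  define FF where "FF = {assign \<sigma> g |\<sigma>. admissible j \<nu> i \<sigma>}"
  have FF: "finite FF" "\<And>f. f \<in> FF \<Longrightarrow> extendable U G f"
    using finite_assignments[OF g] g by (auto simp: FF_def stage_def)
  define N where "N = Max (insert j (dom g))"
  obtain x v u where x: "x \<in> const_words N" and v: "v \<in> var_words n (Max (insert N (dom x)))"
    and u: "u \<in> const_words (Max (insert N (dom x \<union> dom v)))"
    and \<psi>: "\<And>f. f \<in> FF \<Longrightarrow> n = D \<Longrightarrow> \<psi> (f ++ x) (Min (dom v))"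
    and extd: "\<And>f a. f \<in> FF \<Longrightarrow> a \<in> S n \<Longrightarrow> extendable U G (f ++ x ++ sub a v ++ u)"
    using extension_step[OF U V FF, where Q = "n = D" and \<psi> = \<psi> and N = N] G by blast
  \<comment> \<open>The variable letter \<open>Suc k\<close> of \<open>v\<close> is renamed to the
    fresh letter \<open>Suc k + l\<close>.\<close>
  define w where "w = sub (Suc k + l) v"
  define g' where "g' = g ++ x ++ w ++ u"
  define \<mu> where "\<mu> = Min (dom v)"
  have fg: "finite (dom g)" and gj: "dom g \<subseteq> {j<..}" using g by (auto simp: stage_def)
  have fx: "finite (dom x)" and fv: "finite (dom v)" "dom v \<noteq> {}" and fu: "finite (dom u)"
    using x v u by (auto simp: const_words_def var_words_def)
  have N: "j \<le> N" "s \<in> dom g \<Longrightarrow> s \<le> N" for s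
    using fg by (auto simp: N_def)
  have \<mu>v: "\<mu> \<in> dom v" using fv by (simp add: \<mu>_def)
  have xN: "N < s" if "s \<in> dom x" for s using that x by (auto simp: const_words_def)
  have vN: "N < s" "s' \<in> dom x \<Longrightarrow> s' < s" if "s \<in> dom v" for s s'
    using that v fx by (auto simp: var_words_def subset_iff)
  have uN: "N < s" "s' \<in> dom x \<Longrightarrow> s' < s" "s' \<in> dom v \<Longrightarrow> s' < s" if "s \<in> dom u" for s s'
    using that u fx fv by (auto simp: const_words_def subset_iff)
  have dw: "dom w = dom v" by (simp add: w_def dom_sub)
  have w: "w s = Some a \<Longrightarrow> a \<in> \<Lambda> s \<or> a = Suc k + l \<and> \<mu> \<le> s \<and> s \<in> T n" for s a
  proof -
    assume "w s = Some a"
    then obtain b where b: "v s = Some b" "a = (if b \<le> k then b else Suc k + l)"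
      by (auto simp: w_def sub_def)
    moreover have "b \<in> \<Lambda> s \<or> b = Suc k \<and> s \<in> T n"
      using b v by (simp add: var_words_def)
    moreover have "\<mu> \<le> s" unfolding \<mu>_def by (rule Min_le[OF fv(1)]) (use b in auto)
    ultimately show ?thesis using \<Lambda>_le[of b s] by auto
  qed
  have v\<mu>: "v \<mu> = Some (Suc k)" and T\<mu>: "\<mu> \<in> T n"
    using v \<Lambda>_le[of "Suc k" \<mu>] by (auto simp: var_words_def \<mu>_def)
  have dg': "dom g' = dom g \<union> dom x \<union> dom v \<union> dom u"
    by (auto simp: g'_def dw)
  have new: "a \<in> \<Lambda> s \<or> a = Suc k + l \<and> \<mu> \<le> s \<and> s \<in> T n" if "s \<notin> dom g" "g' s = Some a" for s a
  proof -
    have "u s = Some a \<or> w s = Some a \<or> x s = Some a"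
      using that by (auto simp: g'_def map_add_Some_iff)
    then show ?thesis using w[of s a] x u by (auto simp: const_words_def)
  qed
  have old: "g' s = g s" if "s \<in> dom g" for s
  proof -
    have "s \<notin> dom x" "s \<notin> dom w" "s \<notin> dom u"
      using N(2)[OF that] xN[of s] vN(1)[of s] uN(1)[of s] dw by auto
    then show ?thesis by (simp add: g'_def map_add_dom_app_simps)
  qed
  \<comment> \<open>Cut at the first occurrence of the new variable, the new word is the old one
    followed by \<open>x\<close>, and for the instances of exactly this word \<open>v\<close> was
    chosen to start at a good position.\<close>
  have restr: "g' |` {..<\<mu>} = g ++ x"
  proof (rule ext)
    fix s
    show "(g' |` {..<\<mu>}) s = (g ++ x) s"
    proof (cases "s < \<mu>")
      case True
      have "s \<notin> dom v" using True fv by (auto simp: \<mu>_def dest: Min_le[OF fv(1)])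
      moreover have "s \<notin> dom u" using True uN(3)[OF _ \<mu>v, of s] by auto
      ultimately show ?thesis using True by (simp add: g'_def map_add_dom_app_simps dw)
    next
      case False
      have "s \<notin> dom g" "s \<notin> dom x"
        using False N(2)[of s] vN(1)[OF \<mu>v] vN(2)[OF \<mu>v, of s] by auto
      then show ?thesis using False by (simp add: map_add_dom_app_simps domIff)
    qed
  qed
  have assign_g': "assign \<sigma> g' = assign \<sigma> g ++ x ++ sub (\<sigma> l) v ++ u" for \<sigma>
    using x u by (simp add: g'_def assign_add assign_const_words assign_sub w_def del: add_Suc)
  have "stage j \<nu> (extendable U G) (Suc i) g'"
    unfolding stage_def
  proof (intro conjI allI impI)
    show "finite (dom g')" by (simp add: dg' fg fx fv fu)
    show "dom g' \<subseteq> {j<..}"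
      using gj xN vN(1) uN(1) N(1) unfolding dg' by fastforce
    fix s a assume a: "g' s = Some a"
    show "a \<in> \<Lambda> s \<or> (\<exists>l. j < l \<and> l \<le> j + Suc i \<and> a = Suc k + l \<and> s \<in> T (\<nu> l))"
    proof (cases "s \<in> dom g")
      case True
      then have "g s = Some a" using old a by simp
      then have "a \<in> \<Lambda> s \<or> (\<exists>l. j < l \<and> l \<le> j + i \<and> a = Suc k + l \<and> s \<in> T (\<nu> l))"
        using g by (simp add: stage_def)
      then show ?thesis by (elim disjE exE) (simp, rule disjI2, rule_tac x = l in exI, simp)
    next
      case False
      then show ?thesis using new[OF False a] n by (auto simp: l_def)
    qed
  next
    fix \<sigma> assume \<sigma>: "admissible j \<nu> (Suc i) \<sigma>"
    then have "assign \<sigma> g \<in> FF" by (auto simp: FF_def admissible_def)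
    moreover have "\<sigma> l \<in> S n" using \<sigma> n by (simp add: admissible_def l_def)
    ultimately show "extendable U G (assign \<sigma> g')" unfolding assign_g' by (rule extd)
  qed
  moreover have "next_stage j \<nu> \<psi> D i g g' \<mu>"
    unfolding next_stage_def Let_def l_def[symmetric]
  proof (intro conjI ballI allI impI)
    show "s < \<mu>" if "s \<in> dom g" for s using N(2)[OF that] vN(1)[OF \<mu>v] by simp
    show "g' s = g s" if "s \<in> dom g" for s by (rule old[OF that])
    show "s' < s" if "s \<in> dom g' - dom g" "s' \<in> dom g" for s s'
    proof -
      have "s \<in> dom x \<or> s \<in> dom v \<or> s \<in> dom u" using that(1) unfolding dg' by blast
      then have "N < s" using xN vN(1) uN(1) by blast
      then show ?thesis using N(2)[OF that(2)] by simp
    qed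
    show "j < \<mu>" using N(1) vN(1)[OF \<mu>v] by simp
    show "\<mu> \<in> T (\<nu> l)" using T\<mu> n by (simp add: l_def)
    have "\<mu> \<notin> dom u" using uN(3)[OF _ \<mu>v, of \<mu>] by auto
    then show "g' \<mu> = Some (Suc k + l)"
      using v\<mu> \<mu>v by (simp add: g'_def map_add_dom_app_simps dw) (simp add: w_def sub_def)
    show "a \<in> \<Lambda> s \<or> a = Suc k + l \<and> \<mu> \<le> s" if "s \<notin> dom g" "g' s = Some a" for s a
      using new[OF that] by auto
    fix \<sigma> assume "\<nu> l = D" "admissible j \<nu> i \<sigma>"
    then have "\<psi> (assign \<sigma> g ++ x) \<mu>"
      unfolding \<mu>_def by (intro \<psi>) (auto simp: n l_def FF_def)
    then show "\<psi> (assign \<sigma> (g' |` {..<\<mu>})) \<mu>"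
      by (simp add: restr assign_add assign_const_words[OF x])
  qed
  ultimately show thesis by (rule that)
qed

theorem homogeneous_word_exists:
  fixes \<phi> :: "(nat \<Rightarrow> nat) \<Rightarrow> nat \<Rightarrow> bool"
  assumes local: "\<And>f f' q. (\<And>s. j < s \<Longrightarrow> s < q \<Longrightarrow> f s = f' s) \<Longrightarrow> \<phi> f q = \<phi> f' q"
  shows "\<exists>h \<mu> b. homogeneous_word j \<nu> D \<phi> h \<mu> b"
proof -
  obtain U V where U: "ultra U" "U \<le> W" "word.conv U U = U"
    and V: "\<And>n. ultra (V n)" "\<And>n. V n \<le> F n"
      "\<And>n a. a \<in> S n \<Longrightarrow> word.conv U (filtermap (sub a) (V n)) = U"
    by (rule word_ultrafilters) blast
  have Ub: "U \<noteq> bot" using U by (simp add: ultra_def)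
  \<comment> \<open>Positions that no stage reaches receive an allowed constant, so that finite
    words can be coloured and the limit is total.\<close>
  define \<delta> where "\<delta> s = (SOME a. a \<in> \<Lambda> s)" for s
  have \<delta>: "\<delta> s \<in> \<Lambda> s" for s unfolding \<delta>_def using \<Lambda>_ne by (metis ex_in_conv someI)
  \<comment> \<open>\<open>b\<close> is the limit of the colours along \<open>U\<close> and then
    \<open>V D\<close>, read at the position where the next variable word of kind \<open>D\<close>
    would start.\<close>
  have "\<exists>b. eventually (\<lambda>t. eventually (\<lambda>v. \<phi> (fill \<delta> t) (Min (dom v)) = b) (V D)) U"
  proof (cases "eventually (\<lambda>t. eventually (\<lambda>v. \<phi> (fill \<delta> t) (Min (dom v))) (V D)) U")
    case True
    then show ?thesis by (intro exI[of _ True]) simp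
  next
    case False
    then have "eventually (\<lambda>t. \<not> eventually (\<lambda>v. \<phi> (fill \<delta> t) (Min (dom v))) (V D)) U"
      by (rule ultra_not_eventually[OF U(1)])
    then have "eventually (\<lambda>t. eventually (\<lambda>v. \<not> \<phi> (fill \<delta> t) (Min (dom v))) (V D)) U"
      by (rule eventually_mono) (rule ultra_not_eventually[OF V(1)])
    then show ?thesis by (intro exI[of _ False]) simp
  qed
  then obtain b where b: "eventually (\<lambda>t. eventually (\<lambda>v. \<phi> (fill \<delta> t) (Min (dom v)) = b) (V D)) U"
    by blast
  define \<psi> where "\<psi> t q \<longleftrightarrow> \<phi> (fill \<delta> t) q = b" for t q
  define G where "G t \<longleftrightarrow> eventually (\<lambda>v. \<psi> t (Min (dom v))) (V D)" for t
  define P where "P = extendable U G"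
  have "eventually P U"
    unfolding P_def
    by (rule eventually_extendable(1)[OF U(3)], rule eventually_mono[OF b]) (simp add: G_def \<psi>_def)
  moreover have "eventually (\<lambda>x. x \<in> const_words j) U"
    by (rule filter_leD[OF U(2)]) (auto simp: eventually_W)
  ultimately have "eventually (\<lambda>x. P x \<and> x \<in> const_words j) U" by (rule eventually_conj)
  then obtain g0 where g0: "P g0" "g0 \<in> const_words j"
    using eventually_happens'[OF Ub] by blast
  have "\<exists>st. \<forall>i. stage j \<nu> P i (fst (st i)) \<and> next_stage j \<nu> \<psi> D i (fst (st i)) (fst (st (Suc i))) (snd (st (Suc i)))"
  proof (rule dependent_nat_choice)
    have "stage j \<nu> P 0 g0"
      using g0 assign_const_words[OF g0(2)] by (auto simp: stage_def const_words_def)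
    then show "\<exists>x. stage j \<nu> P 0 (fst x)" by auto
    fix x i assume "stage j \<nu> P i (fst x)"
    then obtain g' \<mu> where "stage j \<nu> P (Suc i) g'" "next_stage j \<nu> \<psi> D i (fst x) g' \<mu>"
      unfolding P_def
      using next_stage_exists[where D = D and G = G and \<psi> = \<psi> and \<nu> = \<nu> and j = j and i = i and g = "fst x",
          OF U V refl] G_def by metis
    then show "\<exists>y. stage j \<nu> P (Suc i) (fst y) \<and> next_stage j \<nu> \<psi> D i (fst x) (fst y) (snd y)"
      by auto
  qed
  then obtain st where st: "\<And>i. stage j \<nu> P i (fst (st i))"
    "\<And>i. next_stage j \<nu> \<psi> D i (fst (st i)) (fst (st (Suc i))) (snd (st (Suc i)))" by blast
  define g where "g i = fst (st i)" for i
  define m where "m i = snd (st i)" for i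
  have stage: "stage j \<nu> P i (g i)" for i using st(1) by (simp add: g_def)
  have nx: "next_stage j \<nu> \<psi> D i (g i) (g (Suc i)) (m (Suc i))" for i
    using st(2) by (simp add: g_def m_def)
  have lt: "s < m (Suc i)" and keep: "g (Suc i) s = g i s" if "s \<in> dom (g i)" for s i
    using nx[of i] that by (auto simp: next_stage_def Let_def)
  have above: "s' < s" if "s \<in> dom (g (Suc i))" "s \<notin> dom (g i)" "s' \<in> dom (g i)" for i s s'
    using nx[of i] that by (auto simp: next_stage_def Let_def)
  have mT: "j < m (Suc i)" "m (Suc i) \<in> T (\<nu> (Suc (j + i)))" "g (Suc i) (m (Suc i)) = Some (Suc k + Suc (j + i))" for i
    using nx[of i] by (auto simp: next_stage_def Let_def)
  have new: "a \<in> \<Lambda> s \<or> a = Suc k + Suc (j + i) \<and> m (Suc i) \<le> s" if "s \<notin> dom (g i)" "g (Suc i) s = Some a" for i s a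
    using nx[of i] that unfolding next_stage_def Let_def by blast
  have hom: "\<psi> (assign \<sigma> (g (Suc i) |` {..<m (Suc i)})) (m (Suc i))"
    if "\<nu> (Suc (j + i)) = D" "admissible j \<nu> i \<sigma>" for i \<sigma>
    using nx[of i] that unfolding next_stage_def Let_def by blast
  have m_dom: "m (Suc i) \<in> dom (g (Suc i))" for i using mT(3) by blast
  have m_mono: "m (Suc i) < m (Suc (Suc i))" for i by (rule lt[OF m_dom])
  have m_ge: "j + Suc i \<le> m (Suc i)" for i
    by (induction i) (use mT(1)[of 0] m_mono in \<open>auto simp: Suc_le_eq intro: le_less_trans\<close>)
  \<comment> \<open>Positions added later exceed the whole domain of the current stage, which
    already contains \<open>m (Suc i)\<close>.\<close>
  have stable: "g N s = g (Suc i) s" if "Suc i \<le> N" "s \<le> m (Suc i)" for N i s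
    using that
  proof (induction N rule: dec_induct)
    case (step N)
    obtain N' where N': "N = Suc N'" using step(1) by (cases N) auto
    have "strict_mono (\<lambda>i. m (Suc i))" using m_mono by (simp add: strict_mono_Suc_iff)
    from strict_mono_less_eq[OF this, of i N'] have "m (Suc i) \<le> m N" using step(1) N' by simp
    have "g (Suc N) s = g N s"
    proof (cases "s \<in> dom (g N)")
      case False
      have "s \<notin> dom (g (Suc N))"
        using above[of s N "m N", OF _ False] m_dom[of N'] N' \<open>m (Suc i) \<le> m N\<close> step(4) by auto
      then show ?thesis using False by (simp add: domIff)
    qed (rule keep)
    then show ?case using step by simp
  qed simp
  \<comment> \<open>By \<open>m_ge\<close>, position \<open>s\<close> is settled at stage
    \<open>Suc s\<close>.\<close>
  define h where "h s = fill \<delta> (g (Suc s)) s" for s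
  have h: "h s = fill \<delta> (g (Suc i)) s" if "s \<le> m (Suc i)" for s i
  proof -
    have "s \<le> m (Suc s)" using m_ge[of s] by simp
    then have "g (Suc s) s = g (Suc i) s"
      using stable[of s "max (Suc s) (Suc i)" s] stable[of i "max (Suc s) (Suc i)" s] that by simp
    then show ?thesis by (simp add: h_def fill_def)
  qed
  define \<mu> where "\<mu> l = m (l - j)" for l
  have \<mu>: "\<mu> (Suc (j + i)) = m (Suc i)" for i by (simp add: \<mu>_def)
  have late: "\<mu> l \<le> s" if "h s = Suc k + l" "j < l" for s l
  proof (rule ccontr)
    obtain i where l: "l = Suc (j + i)" using \<open>j < l\<close> by (metis less_iff_Suc_add)
    assume "\<not> \<mu> l \<le> s"
    then have s: "s < m (Suc i)" by (simp add: l \<mu>)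
    then have "fill \<delta> (g (Suc i)) s = Suc k + l" using h[of s i] that by simp
    then have a: "g (Suc i) s = Some (Suc k + l)"
      using \<Lambda>_le[OF \<delta>, of s] by (auto simp: fill_def split: option.splits)
    show False
    proof (cases "s \<in> dom (g i)")
      case True
      then have "g i s = Some (Suc k + l)" using keep a by simp
      then show False using stage[of i] \<Lambda>_le[of "Suc k + l" s] l by (fastforce simp: stage_def)
    next
      case False
      then show False using new[OF False a] \<Lambda>_le[of "Suc k + l" s] s by auto
    qed
  qed
  have "homogeneous_word j \<nu> D \<phi> h \<mu> b"
    unfolding homogeneous_word_def
  proof (intro conjI allI impI)
    fix l assume "j < l"
    then obtain i where l: "l = Suc (j + i)" by (metis less_iff_Suc_add)
    show "j < \<mu> l" "\<mu> l \<in> T (\<nu> l)" using mT[of i] by (simp_all add: l \<mu>)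
    show "\<mu> l < \<mu> (Suc l)" using m_mono[of i] \<mu>[of "Suc i"] by (simp add: l \<mu>)
    show "h (\<mu> l) = Suc k + l" using h[of "m (Suc i)" i] mT(3)[of i] by (simp add: l \<mu> fill_def)
    fix \<sigma> assume D: "\<nu> l = D" and "\<forall>l'. j < l' \<and> l' < l \<longrightarrow> \<sigma> l' \<in> S (\<nu> l')"
    then have "admissible j \<nu> i \<sigma>" by (simp add: admissible_def l)
    then have "\<psi> (assign \<sigma> (g (Suc i) |` {..<m (Suc i)})) (m (Suc i))"
      using hom D by (simp add: l)
    then have "\<phi> (fill \<delta> (assign \<sigma> (g (Suc i) |` {..<\<mu> l}))) (\<mu> l) = b" by (simp add: \<psi>_def l \<mu>)
    moreover have "inst \<sigma> (h s) = fill \<delta> (assign \<sigma> (g (Suc i) |` {..<\<mu> l})) s" if "s < \<mu> l" for s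
    proof -
      have "h s = fill \<delta> (g (Suc i)) s" using that by (intro h) (simp add: l \<mu>)
      then show ?thesis
        using that \<Lambda>_le[OF \<delta>, of s] by (auto simp: fill_def assign_def inst_def split: option.split)
    qed
    ultimately show "\<phi> (\<lambda>s. inst \<sigma> (h s)) (\<mu> l) = b" using local by metis
  next
    fix s assume "j < s"
    show "h s \<in> \<Lambda> s \<or> (\<exists>l>j. h s = Suc k + l \<and> \<mu> l \<le> s \<and> s \<in> T (\<nu> l))"
    proof (cases "g (Suc s) s")
      case None
      then show ?thesis using \<delta> by (simp add: h_def fill_def)
    next
      case (Some a)
      then have "h s = a" by (simp add: h_def fill_def)
      moreover have "a \<in> \<Lambda> s \<or> (\<exists>l. j < l \<and> a = Suc k + l \<and> s \<in> T (\<nu> l))"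
        using stage[of "Suc s"] Some by (auto simp: stage_def)
      ultimately show ?thesis using late by blast
    qed
  qed
  then show ?thesis by blast
qed

end

section \<open>The pigeonhole principle\<close>

context colored_equivs
begin

text \<open>Axiom A.4 under the hypothesis \<open>good\<close>. Positions are the class indices of
  \<open>A\<close> beyond \<open>j\<close>; the letter a \<le> k sends a class of \<open>A\<close>
  to class \<open>a\<close> of \<open>E0\<close>, and variable \<open>l\<close> sends it to class
  \<open>l\<close> of \<open>A'\<close>. If class \<open>Suc k\<close> of \<open>E\<close> starts
  with class \<open>l\<close> of \<open>A'\<close>, then \<open>E\<close> assigns constants to the
  variables before \<open>l\<close>, and \<open>r (Suc k) E\<close> is read off from this instance
  of \<open>h\<close> below \<open>\<mu> l\<close>.\<close>

lemma pigeonhole: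
  assumes A: "A \<in> R" and E0: "E0 \<in> R" "A \<subseteq> E0" and pk: "p k E0 = p j A" and good: "good k A"
  shows "\<exists>A'\<in>R. A \<subseteq> A' \<and> r j A' = r j A \<and>
    ((\<forall>E\<in>R. A' \<subseteq> E \<and> r k E = r k E0 \<longrightarrow> r (Suc k) E \<in> \<O>) \<or>
     (\<forall>E\<in>R. A' \<subseteq> E \<and> r k E = r k E0 \<longrightarrow> r (Suc k) E \<notin> \<O>))"
proof -
  note iA = R_inf_equiv[OF A] and iE0 = R_inf_equiv[OF E0(1)]
  define \<Lambda> where "\<Lambda> s = {a. a \<le> k \<and> (\<forall>x. idx A x = s \<longrightarrow> col x \<in> I (c a))}" for s
  \<comment> \<open>Only finitely many sets \<open>\<Lambda> s\<close> occur, so infinitely many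
    positions of each colour share one. A variable confined to these admits the same constants at
    all its occurrences.\<close>
  have "\<exists>S. infinite {s. c s = c l \<and> \<Lambda> s = S}" for l
  proof -
    have "finite (\<Lambda> ` {s. c s = c l})"
      by (rule finite_subset[of _ "Pow {..k}"]) (auto simp: \<Lambda>_def)
    from pigeonhole_infinite[OF recurrent this] obtain t where
      "infinite {s \<in> {s. c s = c l}. \<Lambda> s = \<Lambda> t}" by blast
    then show ?thesis by auto
  qed
  then obtain S where S: "\<And>l. infinite {s. c s = c l \<and> \<Lambda> s = S l}" by metis
  \<comment> \<open>A kind is named by the least index with the given value of \<open>c\<close>, not
    by the value itself: every \<open>T n\<close> has to be infinite, and \<open>c\<close> may omit
    values.\<close>
  define \<nu> where "\<nu> l = (LEAST l'. c l' = c l)" for l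
  have c\<nu>: "c (\<nu> l) = c l" for l unfolding \<nu>_def by (rule LeastI) simp
  define T where "T l = {s. c s = c l \<and> \<Lambda> s = S l}" for l
  interpret restricted_words k \<Lambda> T S
  proof
    show "\<Lambda> s \<noteq> {}" for s
      using good by (auto simp: \<Lambda>_def good_def)
  qed (use S in \<open>auto simp: T_def \<Lambda>_def\<close>)
  \<comment> \<open>The index of \<open>x\<close> in the relation coded by \<open>f\<close>: classes
    of \<open>A\<close> before the \<open>j\<close>-th go where \<open>E0\<close> puts them, the
    \<open>j\<close>-th goes to class \<open>k\<close>, and the letters decide the rest.\<close>
  define w where "w f x = (if idx A x < j then idx E0 x else if idx A x = j then k else f (idx A x))"
    for f :: "nat \<Rightarrow> nat" and x
  define \<phi> where "\<phi> f q \<longleftrightarrow> {(x, y). x < p q A \<and> y < p q A \<and> w f x = w f y} \<in> \<O>" for f q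
  have "\<phi> f q = \<phi> f' q" if "\<And>s. j < s \<Longrightarrow> s < q \<Longrightarrow> f s = f' s" for f f' q
  proof -
    have "w f x = w f' x" if "x < p q A" for x
      using \<open>\<And>s. j < s \<Longrightarrow> s < q \<Longrightarrow> f s = f' s\<close>[of "idx A x"] idx_less[OF iA that]
      by (auto simp: w_def)
    then have "{(x, y). x < p q A \<and> y < p q A \<and> w f x = w f y} =
      {(x, y). x < p q A \<and> y < p q A \<and> w f' x = w f' y}" by auto
    then show ?thesis by (simp add: \<phi>_def)
  qed
  from homogeneous_word_exists[of j \<phi> \<nu> "\<nu> (Suc k)", OF this] obtain h \<mu> b
    where "homogeneous_word j \<nu> (\<nu> (Suc k)) \<phi> h \<mu> b" by blast
  then have \<mu>: "\<And>l. j < l \<Longrightarrow> j < \<mu> l" "\<And>l. j < l \<Longrightarrow> \<mu> l < \<mu> (Suc l)"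
      "\<And>l. j < l \<Longrightarrow> h (\<mu> l) = Suc k + l" "\<And>l. j < l \<Longrightarrow> \<mu> l \<in> T (\<nu> l)"
    and h: "\<And>s. j < s \<Longrightarrow> h s \<in> \<Lambda> s \<or> (\<exists>l>j. h s = Suc k + l \<and> \<mu> l \<le> s \<and> s \<in> T (\<nu> l))"
    and hom: "\<And>l \<sigma>. j < l \<Longrightarrow> \<nu> l = \<nu> (Suc k) \<Longrightarrow> (\<And>l'. j < l' \<Longrightarrow> l' < l \<Longrightarrow> \<sigma> l' \<in> S (\<nu> l')) \<Longrightarrow>
       \<phi> (\<lambda>s. inst \<sigma> (h s)) (\<mu> l) = b"
    unfolding homogeneous_word_def by simp_all
  have h_const: "h s \<in> \<Lambda> s" if "j < s" "h s \<le> k" for s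
    using h[OF that(1)] that(2) by auto
  have h_var: "\<exists>l>j. h s = Suc k + l \<and> \<mu> l \<le> s \<and> s \<in> T (\<nu> l)" if "j < s" "\<not> h s \<le> k" for s
    using h[OF that(1)] that(2) \<Lambda>_le[of "h s" s] by auto
  \<comment> \<open>For a constant \<open>a\<close>, the class is joined to the class of
    \<open>A\<close> containing \<open>p a E0\<close>, which has index at most \<open>j\<close>; for
    variable \<open>l\<close> the subtraction returns \<open>l\<close>.\<close>
  define f where "f x = (let s = idx A x in
    if s \<le> j then s else if h s \<le> k then idx A (p (h s) E0) else h s - Suc k)" for x
  define m where "m t = (if t \<le> j then p t A else p (\<mu> t) A)" for t
  have pE0: "p (idx A (p i E0)) A = p i E0" for i
    using coarser_p[OF iA iE0 E0(2), of i] by (metis idx_p[OF iA])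
  have idx_le_j: "idx A (p a E0) \<le> j" if "a \<le> k" for a
    using pE0[of a] pk p_le_iff[OF iA, of "idx A (p a E0)" j] p_le_iff[OF iE0, of a k] that by simp
  have mono: "strict_mono m"
  proof (rule strict_mono_Suc_iff[THEN iffD2], rule allI)
    fix t
    show "m t < m (Suc t)"
      using \<mu>(1)[of "Suc t"] \<mu>(2)[of t] by (auto simp: m_def p_less_iff[OF iA])
  qed
  have fm: "f (m t) = t" for t
  proof (cases "t \<le> j")
    case True
    then show ?thesis by (simp add: f_def m_def idx_p[OF iA])
  next
    case False
    then show ?thesis using \<mu>(1,3)[of t] by (simp add: f_def m_def idx_p[OF iA])
  qed
  have mf: "m (f x) \<le> x" for x
  proof -
    define s where "s = idx A x"
    have "m (f x) \<le> p s A"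
    proof (cases "s \<le> j")
      case True
      then show ?thesis by (simp add: f_def m_def s_def)
    next
      case False
      show ?thesis
      proof (cases "h s \<le> k")
        case True
        then show ?thesis
          using False idx_le_j[OF True] by (simp add: f_def m_def Let_def p_le_iff[OF iA] flip: s_def)
      next
        case hs: False
        then obtain l where "l > j" "h s = Suc k + l" "\<mu> l \<le> s" using h_var[of s] False by auto
        then show ?thesis
          using False by (simp add: f_def m_def Let_def p_le_iff[OF iA] flip: s_def)
      qed
    qed
    then show ?thesis using p_idx_le[OF iA, of x] by (simp add: s_def)
  qed
  define A' where "A' = ker f"
  have c_idx: "c (idx A (p i E0)) = c i" for i
    using R_col[OF A, of "idx A (p i E0)"] R_col[OF E0(1), of i] pE0[of i] by simp
  have A': "A' \<in> R"
    unfolding A'_def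
  proof (rule ker_in_R[OF mono fm mf])
    fix t show "col (m t) = c t"
      using \<mu>(4)[of t] R_col[OF A] by (auto simp: m_def T_def c\<nu>)
  next
    fix x
    define s where "s = idx A x"
    have x: "col x \<in> I (c s)" using R_class[OF A, of x] by (simp add: s_def)
    consider "s \<le> j" | "j < s" "h s \<le> k" | "j < s" "\<not> h s \<le> k" by linarith
    then show "col x \<in> I (c (f x))"
    proof cases
      case 1
      then show ?thesis using x by (simp add: f_def s_def)
    next
      case 2
      then have "col x \<in> I (c (h s))" using h_const[OF 2] by (simp add: \<Lambda>_def s_def)
      then show ?thesis using 2 by (simp add: f_def Let_def c_idx flip: s_def)
    next
      case 3
      then obtain l where "h s = Suc k + l" "s \<in> T (\<nu> l)" using h_var by blast
      then show ?thesis using 3 x by (simp add: f_def Let_def T_def c\<nu> flip: s_def)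
    qed
  qed
  note iA' = R_inf_equiv[OF A']
  have pA': "p t A' = m t" and idxA': "idx A' x = f x" for t x
    unfolding A'_def by (rule p_ker[OF mono fm mf] idx_ker[OF mono fm mf])+
  have AA': "A \<subseteq> A'"
    by (auto simp: A'_def ker_def f_def idx_eq_iff[OF iA, symmetric])
  have rj: "r j A' = r j A"
    by (rule R_r_eqI[OF A A' AA']) (simp add: pA' m_def)
  have main: "r (Suc k) E \<in> \<O> \<longleftrightarrow> b" if E: "E \<in> R" "A' \<subseteq> E" and rE: "r k E = r k E0" for E
  proof -
    note iE = R_inf_equiv[OF E(1)]
    have pE: "p a E = p a E0" if "a \<le> k" for a by (rule r_eq_p[OF iE iE0 rE that])
    obtain l where l: "p (Suc k) E = p l A'" using coarser_p[OF iA' iE E(2)] .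
    have "p j A' = p k E" using pE[of k] pk by (simp add: pA' m_def)
    then have "p j A' < p l A'" using l p_less_iff[OF iE, of k "Suc k"] by simp
    then have jl: "j < l" by (simp add: p_less_iff[OF iA'])
    \<comment> \<open>One number is the minimum of index \<open>l\<close> in \<open>A'\<close> and
      of index \<open>Suc k\<close> in \<open>E\<close>. This is why the word was made homogeneous
      for the kind of \<open>Suc k\<close>.\<close>
    have "c l = c (Suc k)" using l R_col[OF A', of l] R_col[OF E(1), of "Suc k"] by simp
    then have \<nu>l: "\<nu> l = \<nu> (Suc k)" by (simp add: \<nu>_def)
    define \<sigma> where "\<sigma> l' = idx E (p l' A')" for l'
    have idxE: "idx E x = \<sigma> (f x)" for x
      using rel_p_idx[OF iA', of x] E(2) by (auto simp: \<sigma>_def idxA' idx_eq_iff[OF iE])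
    \<comment> \<open>Class \<open>\<mu> l'\<close> of \<open>A\<close> is part of class
      \<open>l'\<close> of \<open>A'\<close>, which \<open>E\<close> puts into its class
      \<open>\<sigma> l'\<close>; so this constant is allowed at position \<open>\<mu> l'\<close>,
      hence on all of \<open>T (\<nu> l')\<close>.\<close>
    have "\<sigma> l' \<in> S (\<nu> l')" if l': "j < l'" "l' < l" for l'
    proof -
      have "p l' A' < p (Suc k) E" using l' l by (simp add: p_less_iff[OF iA'])
      then have "\<sigma> l' \<le> k" using idx_less[OF iE, of "p l' A'" "Suc k"] by (simp add: \<sigma>_def less_Suc_eq_le)
      moreover have "col x \<in> I (c (\<sigma> l'))" if "idx A x = \<mu> l'" for x
      proof -
        have "f x = l'" using that \<mu>(1,3)[OF l'(1)] by (simp add: f_def)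
        then show ?thesis using R_class[OF E(1), of x] idxE[of x] by simp
      qed
      ultimately have "\<sigma> l' \<in> \<Lambda> (\<mu> l')" by (simp add: \<Lambda>_def)
      then show ?thesis using \<Lambda>_T[OF \<mu>(4)[OF l'(1)]] by simp
    qed
    then have "\<phi> (\<lambda>s. inst \<sigma> (h s)) (\<mu> l) = b" by (rule hom[OF jl \<nu>l])
    moreover have w: "w (\<lambda>s. inst \<sigma> (h s)) x = idx E x" for x
    proof -
      define s where "s = idx A x"
      consider "s < j" | "s = j" | "j < s" "h s \<le> k" | "j < s" "\<not> h s \<le> k" by linarith
      then show ?thesis
      proof cases
        case 1
        have "p s A < p k E" using 1 pE[of k] pk by (simp add: p_less_iff[OF iA])
        then have "idx E (p s A) = idx E0 (p s A)" by (rule r_eqD(3)[OF iE iE0 rE])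
        moreover have "(x, p s A) \<in> A" using rel_p_idx[OF iA, of x] by (simp add: s_def)
        then have "(x, p s A) \<in> E" "(x, p s A) \<in> E0" using AA' E(2) E0(2) by auto
        then have "idx E x = idx E (p s A)" "idx E0 x = idx E0 (p s A)"
          by (simp_all add: idx_eq_iff[OF iE] idx_eq_iff[OF iE0])
        ultimately show ?thesis using 1 by (simp add: w_def s_def)
      next
        case 2
        then have "idx E x = \<sigma> j" using idxE[of x] by (simp add: f_def s_def)
        also have "\<dots> = k" using \<open>p j A' = p k E\<close> by (simp add: \<sigma>_def idx_p[OF iE])
        finally show ?thesis using 2 by (simp add: w_def s_def)
      next
        case 3
        define t where "t = idx A (p (h s) E0)"
        have "f x = t" using 3 by (simp add: f_def Let_def t_def flip: s_def)
        have "t \<le> j" using idx_le_j 3 by (simp add: t_def)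
        then have "p t A' = p (h s) E"
          using pE0[of "h s"] pE[of "h s"] 3 by (simp add: pA' m_def flip: t_def)
        then have "idx E x = h s"
          using idxE[of x] \<open>f x = t\<close> by (simp add: \<sigma>_def idx_p[OF iE])
        then show ?thesis using 3 by (simp add: w_def inst_def flip: s_def)
      next
        case 4
        then have "f x = h s - Suc k" by (simp add: f_def Let_def flip: s_def)
        then show ?thesis using 4 idxE[of x] by (simp add: w_def inst_def flip: s_def)
      qed
    qed
    moreover have "p (\<mu> l) A = p (Suc k) E" using jl l by (simp add: pA' m_def)
    moreover have "r (Suc k) E = {(x, y). x < p (Suc k) E \<and> y < p (Suc k) E \<and> idx E x = idx E y}"
      by (auto simp: r_def idx_eq_iff[OF iE])
    ultimately show ?thesis by (simp add: \<phi>_def)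
  qed
  show ?thesis
    by (rule bexI[OF _ A']) (use AA' rj main in \<open>cases b; auto\<close>)
qed

section \<open>Open sets, null sets and the Ellentuck topology\<close>

definition below :: "eqrel \<Rightarrow> eqrel \<Rightarrow> eqrel set" where
  "below b A = {E \<in> R. A \<subseteq> E \<and> (\<exists>n. r n E = b)}"

lemma below_r_iff:
  assumes "F \<in> R"
  shows "E \<in> below (r n F) A \<longleftrightarrow> E \<in> R \<and> A \<subseteq> E \<and> r n E = r n F"
proof
  assume E: "E \<in> below (r n F) A"
  then obtain m where "r m E = r n F" by (auto simp: below_def)
  moreover have "E \<in> R" using E by (simp add: below_def)
  ultimately have "m = n" using r_eqD(1) R_inf_equiv assms by metis
  then show "E \<in> R \<and> A \<subseteq> E \<and> r n E = r n F"
    using E \<open>r m E = r n F\<close> by (simp add: below_def)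
qed (auto simp: below_def)

lemma below_mono: "A \<subseteq> A' \<Longrightarrow> below b A' \<subseteq> below b A"
  by (auto simp: below_def)

lemma below_r_mono:
  assumes "E \<in> R" "i \<le> n"
  shows "below (r n E) A \<subseteq> below (r i E) A"
proof
  fix F assume "F \<in> below (r n E) A"
  then show "F \<in> below (r i E) A"
    using R_r_mono[OF assms(1) _ _ assms(2), of F] by (simp add: below_r_iff[OF assms(1)])
qed

lemma coarser_R_p:
  assumes "A \<in> R" "E \<in> R" "A \<subseteq> E"
  obtains j where "p n E = p j A" "n \<le> j"
  using coarser_p[OF R_inf_equiv[OF assms(1)] R_inf_equiv[OF assms(2)] assms(3)] .

lemma amalgamation_below:
  assumes "A \<in> R" "E \<in> R" "A \<subseteq> E" "p n E = p j A"
  shows "\<exists>A'\<in>R. A \<subseteq> A' \<and> r j A' = r j A \<and> below (r n E) A' \<subseteq> below (r n E) E"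
proof -
  obtain A' where A': "A' \<in> R" "A \<subseteq> A'" "r j A' = r j A"
    and F: "\<forall>F\<in>R. A' \<subseteq> F \<and> r n F = r n E \<longrightarrow> E \<subseteq> F"
    using amalgamation[OF assms] by (elim bexE conjE)
  have "below (r n E) A' \<subseteq> below (r n E) E"
  proof
    fix G assume "G \<in> below (r n E) A'"
    then show "G \<in> below (r n E) E" using F by (simp add: below_r_iff[OF assms(2)])
  qed
  then show ?thesis using A' by blast
qed

lemma finite_stage:
  assumes "finite B" and A: "A \<in> R"
    and her: "\<And>b A A'. Q b A \<Longrightarrow> A \<in> R \<Longrightarrow> A' \<in> R \<Longrightarrow> A \<subseteq> A' \<Longrightarrow> Q b A'"
    and step: "\<And>b A'. b \<in> B \<Longrightarrow> A' \<in> R \<Longrightarrow> A \<subseteq> A' \<Longrightarrow> r j A' = r j A \<Longrightarrow>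
      \<exists>A''\<in>R. A' \<subseteq> A'' \<and> r j A'' = r j A' \<and> Q b A''"
  shows "\<exists>A'\<in>R. A \<subseteq> A' \<and> r j A' = r j A \<and> (\<forall>b\<in>B. Q b A')"
  using assms(1) step
proof (induction B rule: finite_induct)
  case empty
  then show ?case using A by blast
next
  case (insert b B)
  obtain A1 where A1: "A1 \<in> R" "A \<subseteq> A1" "r j A1 = r j A" "\<forall>b\<in>B. Q b A1"
    using insert.IH insert.prems by (metis insertCI)
  obtain A2 where A2: "A2 \<in> R" "A1 \<subseteq> A2" "r j A2 = r j A1" "Q b A2"
    using insert.prems[of b A1] A1 by blast
  have "\<forall>b\<in>insert b B. Q b A2" using A1 A2 her by blast
  then show ?case using A1 A2 by (intro bexI[of _ A2]) auto
qed

text \<open>Only finitely many approximations end at \<open>p j A\<close>. They are treated one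
  after the other while \<open>r j A\<close> is kept, and fusion collects all j \<ge> k.\<close>

lemma fusion_all:
  assumes C: "C \<in> R"
    and her: "\<And>j b A A'. Q j b A \<Longrightarrow> A \<in> R \<Longrightarrow> A' \<in> R \<Longrightarrow> A \<subseteq> A' \<Longrightarrow> Q j b A'"
    and step: "\<And>j A n E. k \<le> j \<Longrightarrow> A \<in> R \<Longrightarrow> C \<subseteq> A \<Longrightarrow> r k A = r k C \<Longrightarrow>
      E \<in> R \<Longrightarrow> A \<subseteq> E \<Longrightarrow> p n E = p j A \<Longrightarrow> \<exists>A'\<in>R. A \<subseteq> A' \<and> r j A' = r j A \<and> Q j (r n E) A'"
  shows "\<exists>A\<in>R. C \<subseteq> A \<and> r k A = r k C \<and>
    (\<forall>E\<in>R. \<forall>n j. A \<subseteq> E \<and> k \<le> j \<and> p n E = p j A \<longrightarrow> Q j (r n E) A)"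
proof -
  \<comment> \<open>Approximations ending at \<open>p j A\<close> are treated in the step that keeps
    \<open>r j\<close>, and the result of that step is stage \<open>Suc j\<close>; hence the
    shift.\<close>
  define \<Psi> where "\<Psi> i A \<longleftrightarrow> (\<forall>j\<ge>k. i = Suc j \<longrightarrow>
      (\<forall>E\<in>R. \<forall>n. A \<subseteq> E \<and> p n E = p j A \<longrightarrow> Q j (r n E) A))" for i A
  have "\<exists>A\<in>R. C \<subseteq> A \<and> r k A = r k C \<and>
    (\<forall>j\<ge>k. \<exists>A'\<in>R. C \<subseteq> A' \<and> A' \<subseteq> A \<and> r j A = r j A' \<and> \<Psi> j A')"
  proof (rule fusion[OF C])
    show "\<Psi> k C" by (simp add: \<Psi>_def)
    fix j A assume j: "k \<le> j" and A: "A \<in> R" "C \<subseteq> A" "r k A = r k C"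
    define B where "B = {r n E |n E. E \<in> R \<and> A \<subseteq> E \<and> p n E = p j A}"
    have "B \<subseteq> Pow ({..<p j A} \<times> {..<p j A})" by (auto simp: B_def r_def)
    then have "finite B" by (rule finite_subset) simp
    \<comment> \<open>An approximation in \<open>B\<close> may have no continuation left below
      \<open>A'\<close>. It then makes no demand on coarsenings of \<open>A'\<close>, and
      \<open>step\<close>, which asks for a coarsening of \<open>A'\<close> itself, could not be
      applied to it.\<close>
    then have "\<exists>A'\<in>R. A \<subseteq> A' \<and> r j A' = r j A \<and> (\<forall>b\<in>B. below b A' \<noteq> {} \<longrightarrow> Q j b A')"
    proof (rule finite_stage[OF _ A(1)])
      fix b A A' assume "below b A \<noteq> {} \<longrightarrow> Q j b A" "A \<in> R" "A' \<in> R" "A \<subseteq> A'"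
      then show "below b A' \<noteq> {} \<longrightarrow> Q j b A'"
        using her below_mono[of A A' b] by blast
    next
      fix b A' assume b: "b \<in> B" and A': "A' \<in> R" "A \<subseteq> A'" "r j A' = r j A"
      show "\<exists>A''\<in>R. A' \<subseteq> A'' \<and> r j A'' = r j A' \<and> (below b A'' \<noteq> {} \<longrightarrow> Q j b A'')"
      proof (cases "below b A' = {}")
        case True
        then show ?thesis using A'(1) by blast
      next
        case False
        obtain n E where E: "b = r n E" "E \<in> R" "p n E = p j A" using b by (auto simp: B_def)
        obtain F where "F \<in> below b A'" using False by blast
        then have F: "F \<in> R" "A' \<subseteq> F" "r n F = r n E" by (auto simp: E below_r_iff)
        have "p n F = p j A'"
          using R_r_p[OF E(2) F(1,3) order_refl] R_r_p[OF A(1) A'(1,3) order_refl] E(3) by simp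
        moreover have "r k A' = r k C"
          using R_r_mono[OF A(1) A'(1,3) j] A(3) by simp
        ultimately have "\<exists>A''\<in>R. A' \<subseteq> A'' \<and> r j A'' = r j A' \<and> Q j (r n F) A''"
          using step[OF j A'(1)] A(2) A'(2) F by blast
        then show ?thesis using F(3) E(1) by auto
      qed
    qed
    then obtain A' where A': "A' \<in> R" "A \<subseteq> A'" "r j A' = r j A"
      "\<And>b. b \<in> B \<Longrightarrow> below b A' \<noteq> {} \<Longrightarrow> Q j b A'" by blast
    have "Q j (r n E) A'" if "E \<in> R" "A' \<subseteq> E" "p n E = p j A'" for E n
    proof (rule A'(4))
      have "p n E = p j A" using R_r_p[OF A(1) A'(1,3) order_refl] that by simp
      then show "r n E \<in> B" using that A'(2) by (auto simp: B_def)
      show "below (r n E) A' \<noteq> {}" using that by (auto simp: below_def)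
    qed
    then have "\<Psi> (Suc j) A'" by (simp add: \<Psi>_def)
    then show "\<exists>A'\<in>R. A \<subseteq> A' \<and> r j A' = r j A \<and> \<Psi> (Suc j) A'" using A' by blast
  qed
  then obtain A where A: "A \<in> R" "C \<subseteq> A" "r k A = r k C"
    and \<Psi>: "\<And>j. k \<le> j \<Longrightarrow> \<exists>A'\<in>R. C \<subseteq> A' \<and> A' \<subseteq> A \<and> r j A = r j A' \<and> \<Psi> j A'" by auto
  have "Q j (r n E) A" if E: "E \<in> R" "A \<subseteq> E" and j: "k \<le> j" and pn: "p n E = p j A" for E n j
  proof -
    obtain A' where A': "A' \<in> R" "A' \<subseteq> A" "r (Suc j) A = r (Suc j) A'" "\<Psi> (Suc j) A'"
      using \<Psi>[of "Suc j"] j by auto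
    have "p j A = p j A'" by (rule R_r_p[OF A'(1) A(1) A'(3)]) simp
    then have "Q j (r n E) A'" using A'(2,4) E j pn by (auto simp: \<Psi>_def)
    then show ?thesis using her A' A by blast
  qed
  then show ?thesis using A by blast
qed

section \<open>Homogeneity of open sets\<close>

definition ell_open :: "eqrel set \<Rightarrow> bool" where
  "ell_open X \<longleftrightarrow> (\<forall>E\<in>X. \<exists>n. below (r n E) E \<subseteq> X)"

lemma ell_openD: "ell_open X \<Longrightarrow> E \<in> X \<Longrightarrow> \<exists>n. below (r n E) E \<subseteq> X"
  by (simp add: ell_open_def)

text \<open>Combinatorial forcing: \<open>A\<close> accepts \<open>b\<close> if \<open>below b A \<subseteq> X\<close>, and rejects \<open>b\<close> if no \<open>F \<in> below b A\<close>
  accepts \<open>b\<close>.\<close>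

lemma open_homogeneous_good:
  assumes C: "C \<in> R" and good: "\<And>E. E \<in> R \<Longrightarrow> C \<subseteq> E \<Longrightarrow> r k E = r k C \<Longrightarrow> good k E"
    and X: "ell_open X"
  shows "\<exists>A\<in>R. C \<subseteq> A \<and> r k A = r k C \<and> (below (r k C) A \<subseteq> X \<or> below (r k C) A \<inter> X = {})"
proof -
  define rej where "rej b A \<longleftrightarrow> (\<forall>F\<in>below b A. \<not> below b F \<subseteq> X)" for b A
  \<comment> \<open>First fusion: afterwards every approximation of length at least \<open>k\<close>
    realised below \<open>A\<close> is accepted or rejected by \<open>A\<close>.\<close>
  have "\<exists>A\<in>R. C \<subseteq> A \<and> r k A = r k C \<and>
    (\<forall>E\<in>R. \<forall>n j. A \<subseteq> E \<and> k \<le> j \<and> p n E = p j A \<longrightarrow> below (r n E) A \<subseteq> X \<or> rej (r n E) A)"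
  proof (rule fusion_all[OF C])
    fix b A A' assume "below b A \<subseteq> X \<or> rej b A" "A \<subseteq> A'"
    then show "below b A' \<subseteq> X \<or> rej b A'"
      using below_mono[of A A' b] by (auto simp: rej_def)
  next
    fix j A n E assume A: "A \<in> R" and E: "E \<in> R" "A \<subseteq> E" "p n E = p j A"
    show "\<exists>A'\<in>R. A \<subseteq> A' \<and> r j A' = r j A \<and> (below (r n E) A' \<subseteq> X \<or> rej (r n E) A')"
    proof (cases "rej (r n E) A")
      case True
      then show ?thesis using A by blast
    next
      case False
      then obtain F where F: "F \<in> below (r n E) A" "below (r n E) F \<subseteq> X" by (auto simp: rej_def)
      then have F': "F \<in> R" "A \<subseteq> F" "r n F = r n E" by (auto simp: below_r_iff E)
      have "p n F = p j A" using R_r_p[OF E(1) F'(1,3) order_refl] E by simp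
      from amalgamation_below[OF A F'(1,2) this] obtain A' where
        "A' \<in> R" "A \<subseteq> A'" "r j A' = r j A" "below (r n E) A' \<subseteq> below (r n E) F"
        unfolding F'(3) by blast
      with F(2) show ?thesis by (intro bexI[of _ A']) (blast, simp)
    qed
  qed
  then obtain A where A: "A \<in> R" "C \<subseteq> A" "r k A = r k C" and
    all: "\<forall>E\<in>R. \<forall>n j. A \<subseteq> E \<and> k \<le> j \<and> p n E = p j A \<longrightarrow> below (r n E) A \<subseteq> X \<or> rej (r n E) A"
    by (elim bexE conjE)
  have dec: "below (r n E) A \<subseteq> X \<or> rej (r n E) A" if E: "E \<in> R" "A \<subseteq> E" and n: "k \<le> n" for E n
  proof -
    obtain j where "p n E = p j A" "n \<le> j" using coarser_R_p[OF A(1) E] .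
    with n have "A \<subseteq> E \<and> k \<le> j \<and> p n E = p j A" using E by simp
    then show ?thesis by (rule all[rule_format, OF E(1)])
  qed
  show ?thesis
  proof (cases "below (r k C) A \<subseteq> X")
    case True
    then show ?thesis using A by blast
  next
    case False
    then have rejk: "rej (r k C) A" using dec[OF A(1), of k] A(3) by auto
    \<comment> \<open>Second fusion: below its result, rejection by the fixed \<open>A\<close>
      passes to all one-step extensions.\<close>
    define Q where "Q b B \<longleftrightarrow> (rej b A \<longrightarrow> (\<forall>F\<in>below b B. \<forall>n. r n F = b \<and> k \<le> n \<longrightarrow> rej (r (Suc n) F) A))" for b B
    have "\<exists>A2\<in>R. A \<subseteq> A2 \<and> r k A2 = r k A \<and>
      (\<forall>E\<in>R. \<forall>n j. A2 \<subseteq> E \<and> k \<le> j \<and> p n E = p j A2 \<longrightarrow> Q (r n E) A2)"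
    proof (rule fusion_all[OF A(1)])
      fix b B B' assume "Q b B" "B \<subseteq> B'"
      then show "Q b B'" using below_mono[of B B' b] by (auto simp: Q_def)
    next
      fix j B n E assume B: "B \<in> R" "A \<subseteq> B" "r k B = r k A" and E: "E \<in> R" "B \<subseteq> E" "p n E = p j B"
      show "\<exists>A'\<in>R. B \<subseteq> A' \<and> r j A' = r j B \<and> Q (r n E) A'"
      proof (cases "rej (r n E) A \<and> k \<le> n")
        case False
        have "Q (r n E) B"
          unfolding Q_def
        proof (intro impI ballI allI)
          fix F m assume "rej (r n E) A" "F \<in> below (r n E) B" "r m F = r n E \<and> k \<le> m"
          then show "rej (r (Suc m) F) A"
            using r_eqD(1)[of F E m n] R_inf_equiv E(1) False by (auto simp: below_def)
        qed
        then show ?thesis using B by blast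
      next
        case True
        have "C \<subseteq> B" "r k B = r k C" using A B by auto
        then have "good k B" by (rule good[OF B(1)])
        then have "good n B" by (rule good_mono) (use True in simp)
        from pigeonhole[OF B(1) E this, of "{b. below b A \<subseteq> X}"] obtain A' where
          A': "A' \<in> R" "B \<subseteq> A'" "r j A' = r j B" and
          alt: "(\<forall>F\<in>R. A' \<subseteq> F \<and> r n F = r n E \<longrightarrow> below (r (Suc n) F) A \<subseteq> X) \<or>
            (\<forall>F\<in>R. A' \<subseteq> F \<and> r n F = r n E \<longrightarrow> \<not> below (r (Suc n) F) A \<subseteq> X)" by auto
        have AA': "A \<subseteq> A'" using B A' by blast
        have rejF: "rej (r (Suc n) F) A" if F: "F \<in> below (r n E) A'" for F
        proof -
          have F': "F \<in> R" "A' \<subseteq> F" "r n F = r n E" using F by (auto simp: below_r_iff E)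
          have "\<not> below (r (Suc n) F) A \<subseteq> X"
            using alt
          proof
            assume all: "\<forall>F\<in>R. A' \<subseteq> F \<and> r n F = r n E \<longrightarrow> below (r (Suc n) F) A \<subseteq> X"
            \<comment> \<open>If all one-step extensions were accepted, \<open>F\<close> would
              accept \<open>r n E\<close>, which is rejected.\<close>
            have "below (r n E) F \<subseteq> X"
            proof
              fix G assume "G \<in> below (r n E) F"
              then have G: "G \<in> R" "F \<subseteq> G" "r n G = r n E" by (auto simp: below_r_iff E)
              then have "below (r (Suc n) G) A \<subseteq> X" using all F'(2) by blast
              moreover have "G \<in> below (r (Suc n) G) A" using G F' AA' by (auto simp: below_r_iff)
              ultimately show "G \<in> X" by blast
            qed
            moreover have "F \<in> below (r n E) A" using F below_mono[OF AA'] by blast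
            ultimately show ?thesis using True by (auto simp: rej_def)
          qed (use F' in blast)
          then show ?thesis using dec[of F "Suc n"] F' AA' True by auto
        qed
        have "Q (r n E) A'"
          unfolding Q_def
        proof (intro impI ballI allI)
          fix F m assume F: "F \<in> below (r n E) A'" and "r m F = r n E \<and> k \<le> m"
          then have "m = n" using r_eqD(1)[of F E m n] R_inf_equiv E(1) by (auto simp: below_def)
          then show "rej (r (Suc m) F) A" using rejF[OF F] by simp
        qed
        then show ?thesis using A' by blast
      qed
    qed
    then obtain A2 where A2: "A2 \<in> R" "A \<subseteq> A2" "r k A2 = r k A"
      and Q: "\<forall>E\<in>R. \<forall>n j. A2 \<subseteq> E \<and> k \<le> j \<and> p n E = p j A2 \<longrightarrow> Q (r n E) A2"
      by (elim bexE conjE)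
    \<comment> \<open>All sufficiently long approximations of \<open>E\<close> are rejected by
      \<open>A\<close>, whereas openness would make \<open>E\<close>, a coarsening of
      \<open>A\<close>, accept one of them.\<close>
    have "E \<notin> X" if "E \<in> below (r k C) A2" for E
    proof
      assume "E \<in> X"
      have E: "E \<in> R" "A2 \<subseteq> E" "r k E = r k C" using that by (auto simp: below_r_iff C)
      have rejE: "rej (r n E) A" if "k \<le> n" for n
        using that
      proof (induction n rule: dec_induct)
        case base
        then show ?case using rejk E by simp
      next
        case (step n)
        obtain j where "p n E = p j A2" "n \<le> j" using coarser_R_p[OF A2(1) E(1,2)] .
        then have "Q (r n E) A2" using Q[rule_format, OF E(1), of j n] E(2) step(1) by simp
        moreover have "E \<in> below (r n E) A2" using E by (simp add: below_r_iff)
        ultimately show ?case using step by (auto simp: Q_def)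
      qed
      obtain n where "below (r n E) E \<subseteq> X" using X \<open>E \<in> X\<close> by (auto simp: ell_open_def)
      then have "below (r (max n k) E) E \<subseteq> X"
        using below_r_mono[OF E(1), of n "max n k" E] by auto
      moreover have "E \<in> below (r (max n k) E) A" using E A2 by (auto simp: below_r_iff)
      ultimately show False using rejE[of "max n k"] by (auto simp: rej_def)
    qed
    then show ?thesis using A A2 by (intro bexI[of _ A2]) auto
  qed
qed

text \<open>In the rigid case only \<open>A\<close> is left. Otherwise \<open>p K\<close> is
  constant on the coarsenings of \<open>A\<close> that keep \<open>r k\<close>, so keeping
  \<open>r k\<close> already means keeping \<open>r K\<close>, and the good case applies at length
  \<open>K\<close>.\<close>

lemma open_homogeneous:
  assumes B: "B \<in> R" and X: "ell_open X"
  shows "\<exists>A\<in>R. B \<subseteq> A \<and> r k A = r k B \<and> (below (r k B) A \<subseteq> X \<or> below (r k B) A \<inter> X = {})"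
  using rigid_or_good[OF B, of k]
proof
  assume "\<exists>A\<in>R. B \<subseteq> A \<and> r k A = r k B \<and> (\<forall>E\<in>R. A \<subseteq> E \<and> r k E = r k A \<longrightarrow> E = A)"
  then obtain A where A: "A \<in> R" "B \<subseteq> A" "r k A = r k B"
    "\<forall>E\<in>R. A \<subseteq> E \<and> r k E = r k A \<longrightarrow> E = A" by (elim bexE conjE)
  then have "below (r k B) A \<subseteq> {A}" by (auto simp: below_r_iff[OF B])
  then have "below (r k B) A \<subseteq> X \<or> below (r k B) A \<inter> X = {}" by blast
  then show ?thesis using A(1-3) by blast
next
  assume "\<exists>A\<in>R. \<exists>K\<ge>k. B \<subseteq> A \<and> r k A = r k B \<and>
     (\<forall>E\<in>R. A \<subseteq> E \<and> r k E = r k A \<longrightarrow> p K E = p K A \<and> good K E)"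
  then obtain A K where A: "A \<in> R" "k \<le> K" "B \<subseteq> A" "r k A = r k B"
    and "\<forall>E\<in>R. A \<subseteq> E \<and> r k E = r k A \<longrightarrow> p K E = p K A \<and> good K E"
    by (elim bexE exE conjE)
  then have K: "p K E = p K A \<and> good K E" if "E \<in> R" "A \<subseteq> E" "r k E = r k A" for E
    using that by blast
  have "good K E" if "E \<in> R" "A \<subseteq> E" "r K E = r K A" for E
    using K[OF that(1,2) R_r_mono[OF A(1) that(1,3) A(2)]] by simp
  from open_homogeneous_good[OF A(1) this X] obtain A' where
    A': "A' \<in> R" "A \<subseteq> A'" "r K A' = r K A" "below (r K A) A' \<subseteq> X \<or> below (r K A) A' \<inter> X = {}"
    by blast
  have "below (r k B) A' \<subseteq> below (r K A) A'"
  proof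
    fix E assume "E \<in> below (r k B) A'"
    then have E: "E \<in> R" "A' \<subseteq> E" "r k E = r k A" using A by (auto simp: below_r_iff B)
    then have "p K E = p K A" using K A'(2) by blast
    then have "r K E = r K A" using R_r_eqI[OF A(1) E(1)] E A' by blast
    then show "E \<in> below (r K A) A'" using E by (simp add: below_r_iff A)
  qed
  moreover have "r k A' = r k B" using R_r_mono[OF A(1) A'(1,3) A(2)] A by simp
  ultimately show ?thesis using A A' by (intro bexI[of _ A']) auto
qed

section \<open>The ideal of null sets\<close>

definition null :: "eqrel set \<Rightarrow> bool" where
  "null X \<longleftrightarrow> (\<forall>k. \<forall>B\<in>R. \<exists>A\<in>R. B \<subseteq> A \<and> r k A = r k B \<and> below (r k B) A \<inter> X = {})"

lemma nullD:
  assumes "null X" "B \<in> R"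
  obtains A where "A \<in> R" "B \<subseteq> A" "r k A = r k B" "below (r k B) A \<inter> X = {}"
  using assms unfolding null_def by blast

lemma null_empty: "null {}"
  by (auto simp: null_def)

lemma null_Un:
  assumes "null X" "null Y"
  shows "null (X \<union> Y)"
  unfolding null_def
proof (intro allI ballI)
  fix k B assume B: "B \<in> R"
  obtain A1 where A1: "A1 \<in> R" "B \<subseteq> A1" "r k A1 = r k B" "below (r k B) A1 \<inter> X = {}"
    using nullD[OF assms(1) B] .
  obtain A2 where A2: "A2 \<in> R" "A1 \<subseteq> A2" "r k A2 = r k A1" "below (r k A1) A2 \<inter> Y = {}"
    using nullD[OF assms(2) A1(1)] .
  show "\<exists>A\<in>R. B \<subseteq> A \<and> r k A = r k B \<and> below (r k B) A \<inter> (X \<union> Y) = {}"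
    using A1 A2 below_mono[OF A2(2), of "r k B"] by (intro bexI[of _ A2]) auto
qed

text \<open>Fusion avoids the sets \<open>N 0\<close> to \<open>N j\<close> on approximations ending
  at \<open>p j A\<close>. A given \<open>E\<close> escapes \<open>N i\<close> through its
  approximation of length \<open>max k i\<close>, whose end \<open>p j A\<close> has j \<ge>
  i.\<close>

lemma null_UN:
  fixes N :: "nat \<Rightarrow> eqrel set"
  assumes N: "\<And>i. null (N i)"
  shows "null (\<Union>i. N i)"
  unfolding null_def
proof (intro allI ballI)
  fix k B assume B: "B \<in> R"
  have fin: "null (\<Union>i\<le>j. N i)" for j
    by (induction j) (simp_all add: N atMost_Suc null_Un)
  have "\<exists>A\<in>R. B \<subseteq> A \<and> r k A = r k B \<and>
    (\<forall>E\<in>R. \<forall>n j. A \<subseteq> E \<and> k \<le> j \<and> p n E = p j A \<longrightarrow> below (r n E) A \<inter> (\<Union>i\<le>j. N i) = {})"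
  proof (rule fusion_all[OF B])
    fix j b A A' assume "below b A \<inter> (\<Union>i\<le>j. N i) = {}" "A \<subseteq> A'"
    then show "below b A' \<inter> (\<Union>i\<le>j. N i) = {}" using below_mono[of A A' b] by blast
  next
    fix j A n E assume A: "A \<in> R" and E: "E \<in> R" "A \<subseteq> E" "p n E = p j A"
    obtain F where F: "F \<in> R" "E \<subseteq> F" "r n F = r n E" "below (r n E) F \<inter> (\<Union>i\<le>j. N i) = {}"
      using nullD[OF fin E(1)] .
    have "p n F = p j A" using R_r_p[OF E(1) F(1,3) order_refl] E by simp
    moreover have "A \<subseteq> F" using E F by blast
    ultimately obtain A' where "A' \<in> R" "A \<subseteq> A'" "r j A' = r j A" "below (r n E) A' \<subseteq> below (r n E) F"
      using amalgamation_below[OF A F(1), of n j] F(3) by auto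
    with F(4) show "\<exists>A'\<in>R. A \<subseteq> A' \<and> r j A' = r j A \<and> below (r n E) A' \<inter> (\<Union>i\<le>j. N i) = {}"
      by (intro bexI[of _ A']) (blast, simp)
  qed
  then obtain A where A: "A \<in> R" "B \<subseteq> A" "r k A = r k B" and
    avoid: "\<forall>E\<in>R. \<forall>n j. A \<subseteq> E \<and> k \<le> j \<and> p n E = p j A \<longrightarrow> below (r n E) A \<inter> (\<Union>i\<le>j. N i) = {}"
    by (elim bexE conjE)
  have "E \<notin> N i" if "E \<in> below (r k B) A" for E i
  proof -
    have E: "E \<in> R" "A \<subseteq> E" using that by (auto simp: below_def)
    obtain j where "p (max k i) E = p j A" "max k i \<le> j" using coarser_R_p[OF A(1) E] .
    then have "below (r (max k i) E) A \<inter> (\<Union>i\<le>j. N i) = {}" "i \<le> j"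
      using avoid[rule_format, OF E(1), of j "max k i"] E(2) by auto
    moreover have "E \<in> below (r (max k i) E) A" using E by (simp add: below_r_iff)
    ultimately show ?thesis by blast
  qed
  then show "\<exists>A\<in>R. B \<subseteq> A \<and> r k A = r k B \<and> below (r k B) A \<inter> (\<Union>i. N i) = {}"
    using A by (intro bexI[of _ A]) auto
qed

section \<open>Passage to the Ellentuck topology\<close>

lemma basic_eq_below: "A \<in> R \<Longrightarrow> basic R b A = below b A"
proof -
  assume A: "A \<in> R"
  have "coarser E A \<longleftrightarrow> A \<subseteq> E" if "E \<in> R" for E
    by (rule coarser_iff[OF inf_equivD[OF R_inf_equiv[OF that]] inf_equivD[OF R_inf_equiv[OF A]]])
  then show ?thesis by (auto simp: basic_def below_def)
qed

text \<open>A non-empty [a, B] contains some \<open>E\<close> with \<open>a = r n E\<close>, and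
  \<open>B\<close> may be replaced by \<open>E\<close>. So it suffices to treat pairs in which
  \<open>a\<close> is an approximation of \<open>B\<close> itself.\<close>

lemma homogeneous_iff:
  assumes her: "\<And>b A. A \<in> R \<Longrightarrow> Q (below b A) = Q' (basic R b A)"
  shows "(\<forall>a \<in> AR R. \<forall>B \<in> R. basic R a B \<noteq> {} \<longrightarrow> (\<exists>A \<in> basic R a B. Q' (basic R a A))) \<longleftrightarrow>
    (\<forall>k. \<forall>B\<in>R. \<exists>A\<in>R. B \<subseteq> A \<and> r k A = r k B \<and> Q (below (r k B) A))" (is "?L \<longleftrightarrow> ?R")
proof
  assume L: ?L
  show ?R
  proof (intro allI ballI)
    fix k B assume B: "B \<in> R"
    then have "r k B \<in> AR R" "B \<in> basic R (r k B) B"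
      by (auto simp: AR_def basic_eq_below below_r_iff)
    with L B obtain A where "A \<in> basic R (r k B) B" "Q' (basic R (r k B) A)" by blast
    then show "\<exists>A\<in>R. B \<subseteq> A \<and> r k A = r k B \<and> Q (below (r k B) A)"
      using B her by (auto simp: basic_eq_below below_r_iff)
  qed
next
  assume R: ?R
  show ?L
  proof (intro ballI impI)
    fix a B assume B: "B \<in> R" "basic R a B \<noteq> {}"
    then obtain E n where E: "E \<in> R" "B \<subseteq> E" "r n E = a" by (auto simp: basic_eq_below below_def)
    with R obtain A where "A \<in> R" "E \<subseteq> A" "r n A = r n E" "Q (below (r n E) A)" by blast
    then show "\<exists>A \<in> basic R a B. Q' (basic R a A)"
      using B E her by (intro bexI[of _ A]) (auto simp: basic_eq_below below_def)
  qed
qed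

lemma ramsey_iff: "ramsey R X \<longleftrightarrow> (\<forall>k. \<forall>B\<in>R. \<exists>A\<in>R. B \<subseteq> A \<and> r k A = r k B \<and>
    (below (r k B) A \<subseteq> X \<or> below (r k B) A \<inter> X = {}))"
  unfolding ramsey_def
  by (rule homogeneous_iff[where Q = "\<lambda>S. S \<subseteq> X \<or> S \<inter> X = {}" and Q' = "\<lambda>S. S \<subseteq> X \<or> S \<inter> X = {}"])
    (simp add: basic_eq_below)

lemma ramsey_null_iff: "ramsey_null R X \<longleftrightarrow> null X"
  unfolding ramsey_null_def null_def
  by (rule homogeneous_iff[where Q = "\<lambda>S. S \<inter> X = {}" and Q' = "\<lambda>S. S \<inter> X = {}"])
    (simp add: basic_eq_below)

text \<open>A basic set [b, B] containing \<open>E\<close> also contains [b, E] with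
  \<open>b = r n E\<close>, and these neighbourhoods of \<open>E\<close> shrink as \<open>n\<close>
  grows.\<close>

lemma openin_ellentuck: "openin (ellentuck R) U \<longleftrightarrow> U \<subseteq> R \<and> ell_open U"
proof
  assume "openin (ellentuck R) U"
  then have "generate_topology_on {basic R a B |a B. a \<in> AR R \<and> B \<in> R} U"
    by (simp add: ellentuck_def openin_topology_generated_by_iff)
  then show "U \<subseteq> R \<and> ell_open U"
  proof induction
    case (Int U V)
    have "ell_open (U \<inter> V)"
      unfolding ell_open_def
    proof
      fix E assume E: "E \<in> U \<inter> V"
      then obtain m n where "below (r m E) E \<subseteq> U" "below (r n E) E \<subseteq> V"
        using Int.IH ell_openD by (meson IntD1 IntD2)
      moreover have "E \<in> R" using E Int by blast
      ultimately have "below (r (max m n) E) E \<subseteq> U \<inter> V"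
        using below_r_mono[of E m "max m n" E] below_r_mono[of E n "max m n" E] by auto
      then show "\<exists>n. below (r n E) E \<subseteq> U \<inter> V" ..
    qed
    then show ?case using Int by blast
  next
    case (UN K)
    then show ?case by (fastforce simp: ell_open_def)
  next
    case (Basis U)
    then obtain a B where U: "U = below a B" "B \<in> R" by (auto simp: basic_eq_below)
    have "\<exists>n. below (r n E) E \<subseteq> U" if "E \<in> U" for E
      using that below_mono[of B E a] by (auto simp: U(1) below_def)
    then show ?case by (auto simp: ell_open_def U(1) below_def)
  qed (simp add: ell_open_def)
next
  assume U: "U \<subseteq> R \<and> ell_open U"
  define \<B> where "\<B> = {V \<in> {basic R a B |a B. a \<in> AR R \<and> B \<in> R}. V \<subseteq> U}"
  have "U = \<Union>\<B>"
  proof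
    show "U \<subseteq> \<Union>\<B>"
    proof
      fix E assume "E \<in> U"
      then obtain n where n: "below (r n E) E \<subseteq> U" and E: "E \<in> R"
        using U ell_openD[of U E] by blast
      then have "basic R (r n E) E \<subseteq> U" "r n E \<in> AR R" "E \<in> basic R (r n E) E"
        by (auto simp: basic_eq_below below_r_iff AR_def)
      then have "basic R (r n E) E \<in> \<B>" "E \<in> basic R (r n E) E"
        using E by (auto simp: \<B>_def)
      then show "E \<in> \<Union>\<B>" by blast
    qed
  qed (auto simp: \<B>_def)
  moreover have "openin (ellentuck R) (\<Union>\<B>)"
    by (rule openin_Union) (auto simp: \<B>_def ellentuck_def intro: topology_generated_by_Basis)
  ultimately show "openin (ellentuck R) U" by simp
qed

lemma openin_below: "A \<in> R \<Longrightarrow> openin (ellentuck R) (below b A)"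
  unfolding openin_ellentuck ell_open_def
proof (intro conjI ballI)
  fix E assume "E \<in> below b A"
  then obtain n where "b = r n E" "A \<subseteq> E" by (auto simp: below_def)
  then show "\<exists>n. below (r n E) E \<subseteq> below b A" using below_mono[of A E b] by blast
qed (auto simp: below_def)

lemma topspace_ellentuck: "topspace (ellentuck R) = R"
proof
  show "topspace (ellentuck R) \<subseteq> R"
    using openin_topspace[of "ellentuck R"] unfolding openin_ellentuck by blast
  have "openin (ellentuck R) R" by (auto simp: openin_ellentuck ell_open_def below_def)
  then show "R \<subseteq> topspace (ellentuck R)" by (rule openin_subset)
qed

text \<open>Homogeneity of the complement of the closure gives a basic set inside the closure or
  disjoint from it, and empty interior excludes the former. Conversely, a basic set inside the
  closure would contain a point with a basic neighbourhood missing \<open>N\<close>.\<close>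

lemma nowhere_dense_iff_null:
  assumes N: "N \<subseteq> R"
  shows "nowhere_dense_in (ellentuck R) N \<longleftrightarrow> null N"
proof
  assume nd: "nowhere_dense_in (ellentuck R) N"
  let ?cl = "ellentuck R closure_of N"
  show "null N"
    unfolding null_def
  proof (intro allI ballI)
    fix k B assume B: "B \<in> R"
    have "openin (ellentuck R) (R - ?cl)"
      using openin_diff[OF openin_topspace closedin_closure_of[of "ellentuck R" N]]
      by (simp add: topspace_ellentuck)
    then obtain A where A: "A \<in> R" "B \<subseteq> A" "r k A = r k B"
      "below (r k B) A \<subseteq> R - ?cl \<or> below (r k B) A \<inter> (R - ?cl) = {}"
      using open_homogeneous[OF B, of "R - ?cl" k] by (auto simp: openin_ellentuck)
    have "A \<in> below (r k B) A" using A by (simp add: below_r_iff B)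
    have "\<not> below (r k B) A \<subseteq> ?cl"
      using nd \<open>A \<in> below (r k B) A\<close> openin_below[OF A(1), of "r k B"]
      by (auto simp: nowhere_dense_in_def interior_of_eq_empty)
    moreover have "below (r k B) A \<subseteq> R" by (auto simp: below_def)
    ultimately have "below (r k B) A \<inter> ?cl = {}" using A(4) by blast
    moreover have "N \<subseteq> ?cl" by (rule closure_of_subset) (simp add: topspace_ellentuck N)
    ultimately show "\<exists>A\<in>R. B \<subseteq> A \<and> r k A = r k B \<and> below (r k B) A \<inter> N = {}"
      using A by blast
  qed
next
  assume null: "null N"
  have "T = {}" if T: "openin (ellentuck R) T" "T \<subseteq> ellentuck R closure_of N" for T
  proof (rule ccontr)
    assume "T \<noteq> {}"
    then obtain E where "E \<in> T" by blast
    then obtain n where n: "below (r n E) E \<subseteq> T" and E: "E \<in> R"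
      using T(1) ell_openD[of T E] unfolding openin_ellentuck by blast
    obtain A where A: "A \<in> R" "E \<subseteq> A" "r n A = r n E" "below (r n E) A \<inter> N = {}"
      using nullD[OF null E] .
    have "A \<in> below (r n E) E" using A E by (simp add: below_r_iff)
    then have "A \<in> ellentuck R closure_of N" using n T(2) by blast
    moreover have "A \<in> below (r n E) A" using A E by (simp add: below_r_iff)
    ultimately show False
      using openin_below[OF A(1), of "r n E"] A(4) by (auto simp: in_closure_of)
  qed
  then show "nowhere_dense_in (ellentuck R) N"
    using N by (auto simp: nowhere_dense_in_def topspace_ellentuck interior_of_eq_empty)
qed

text \<open>Null sets are closed under countable unions, so meagre sets are already nowhere
  dense.\<close>

lemma meagre_iff_null:
  assumes "X \<subseteq> R"
  shows "meagre_in (ellentuck R) X \<longleftrightarrow> null X"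
proof
  assume "meagre_in (ellentuck R) X"
  then obtain \<N> where \<N>: "countable \<N>" "\<And>N. N \<in> \<N> \<Longrightarrow> nowhere_dense_in (ellentuck R) N" "X = \<Union>\<N>"
    by (auto simp: meagre_in_def)
  show "null X"
  proof (cases "\<N> = {}")
    case False
    have "null (from_nat_into \<N> i)" for i
      using \<N>(2)[OF from_nat_into[OF False]] nowhere_dense_iff_null
      by (metis nowhere_dense_in_def topspace_ellentuck)
    then have "null (\<Union>i. from_nat_into \<N> i)" by (rule null_UN)
    then show ?thesis using range_from_nat_into[OF False \<N>(1)] \<N>(3) by simp
  qed (simp add: \<N>(3) null_empty)
next
  assume "null X"
  then have "nowhere_dense_in (ellentuck R) X" by (simp add: nowhere_dense_iff_null assms)
  then show "meagre_in (ellentuck R) X"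
    unfolding meagre_in_def by (intro exI[of _ "{X}"]) simp
qed

text \<open>Forwards, the meagre part is avoided first and the open part decided next. Backwards, a
  basic set inside \<open>X\<close> lies in the interior of \<open>X\<close>, so removing the
  interior leaves a null set.\<close>

lemma baire_iff_ramsey:
  assumes X: "X \<subseteq> R"
  shows "baire_property_in (ellentuck R) X \<longleftrightarrow> ramsey R X"
proof
  assume "baire_property_in (ellentuck R) X"
  then obtain U M where U: "openin (ellentuck R) U" and M: "meagre_in (ellentuck R) M"
    and eq: "X = sym_diff U M" unfolding baire_property_in_def by (elim exE conjE)
  have "M \<subseteq> X \<union> U" unfolding eq by blast
  moreover have "U \<subseteq> R" using openin_subset[OF U] by (simp add: topspace_ellentuck)
  ultimately have "M \<subseteq> R" using X by blast
  then have "null M" using M by (simp add: meagre_iff_null)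
  show "ramsey R X"
    unfolding ramsey_iff
  proof (intro allI ballI)
    fix k B assume B: "B \<in> R"
    obtain A1 where A1: "A1 \<in> R" "B \<subseteq> A1" "r k A1 = r k B" "below (r k B) A1 \<inter> M = {}"
      using nullD[OF \<open>null M\<close> B] .
    obtain A2 where A2: "A2 \<in> R" "A1 \<subseteq> A2" "r k A2 = r k A1"
      "below (r k A1) A2 \<subseteq> U \<or> below (r k A1) A2 \<inter> U = {}"
      using open_homogeneous[OF A1(1), of U k] U unfolding openin_ellentuck by blast
    have "below (r k B) A2 \<inter> M = {}" using A1(4) below_mono[OF A2(2)] by blast
    then have "below (r k B) A2 \<subseteq> X \<or> below (r k B) A2 \<inter> X = {}"
      using A2(4) A1(3) unfolding eq by auto
    then show "\<exists>A\<in>R. B \<subseteq> A \<and> r k A = r k B \<and> (below (r k B) A \<subseteq> X \<or> below (r k B) A \<inter> X = {})"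
      using A1 A2 by (intro bexI[of _ A2]) auto
  qed
next
  assume ram: "ramsey R X"
  define U where "U = ellentuck R interior_of X"
  have "U \<subseteq> X" by (simp add: U_def interior_of_subset)
  have "null (X - U)"
    unfolding null_def
  proof (intro allI ballI)
    fix k B assume B: "B \<in> R"
    obtain A where A: "A \<in> R" "B \<subseteq> A" "r k A = r k B"
      "below (r k B) A \<subseteq> X \<or> below (r k B) A \<inter> X = {}"
      using ram B unfolding ramsey_iff by blast
    have "below (r k B) A \<subseteq> U" if "below (r k B) A \<subseteq> X"
      unfolding U_def by (rule interior_of_maximal[OF that openin_below[OF A(1)]])
    then show "\<exists>A\<in>R. B \<subseteq> A \<and> r k A = r k B \<and> below (r k B) A \<inter> (X - U) = {}"
      using A by blast
  qed
  then have "meagre_in (ellentuck R) (X - U)"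
    using X by (subst meagre_iff_null) auto
  moreover have "openin (ellentuck R) U" by (simp add: U_def)
  moreover have "X = sym_diff U (X - U)" using \<open>U \<subseteq> X\<close> by auto
  ultimately show "baire_property_in (ellentuck R) X"
    unfolding baire_property_in_def by blast
qed

theorem topological_ramsey_space_R: "topological_ramsey_space R"
  by (simp add: topological_ramsey_space_def baire_iff_ramsey meagre_iff_null ramsey_null_iff)

end

section \<open>The given space as a space of coloured relations\<close>

theorem theorem5p3:
  fixes P I :: "nat \<Rightarrow> nat set"
  assumes "partition_on UNIV (range P)"
    and "\<And>n. infinite (P n)"
    and "\<And>i j. i < j \<Longrightarrow> Inf (P i) < Inf (P j)"
    and "\<And>n. n \<in> I n"
  shows "topological_ramsey_space (E_infty P I)"
proof -
  have "P i \<inter> P j = {}" if "i \<noteq> j" for i j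
  proof -
    have "Inf (P i) \<noteq> Inf (P j)"
      using assms(3)[of i j] assms(3)[of j i] that by (cases i j rule: linorder_cases) simp_all
    then have "P i \<noteq> P j" by (rule contrapos_nn) simp
    then show ?thesis
      using disjointD[OF partition_onD2[OF assms(1)], of "P i" "P j"] by simp
  qed
  moreover have "\<exists>n. x \<in> P n" for x using assms(1) by (auto simp: partition_on_def)
  ultimately have P: "\<exists>!n. x \<in> P n" for x by (metis disjoint_iff)
  define col where "col x = (THE n. x \<in> P n)" for x
  have col: "x \<in> P n \<longleftrightarrow> col x = n" for x n
    unfolding col_def using theI'[OF P[of x]] P[of x] by blast
  define c :: "nat \<Rightarrow> nat" where "c k = multiplicity 2 (k + 1)" for k
  have c: "(2 ^ n dvd k + 1 \<and> (\<forall>m. 2 ^ m dvd k + 1 \<longrightarrow> m \<le> n)) \<longleftrightarrow> c k = n" for n k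
    by (auto simp: c_def power_dvd_iff_le_multiplicity intro: antisym)
  interpret colored_equivs col c I
  proof
    fix k
    \<comment> \<open>\<open>f t + 1\<close> runs through the odd multiples of
      \<open>2 ^ c k\<close>, the numbers with the same exponent of \<open>2\<close> as
      \<open>k + 1\<close>.\<close>
    define f :: "nat \<Rightarrow> nat" where "f t = 2 ^ c k * (2 * t + 1) - 1" for t
    have f: "f t + 1 = 2 ^ c k * (2 * t + 1)" for t by (simp add: f_def)
    have "inj f"
      by (rule injI) (metis f add_right_cancel mult_cancel_left power_not_zero zero_neq_numeral)
    moreover have "c (f t) = c k" for t
      unfolding c_def f unfolding c_def by (rule multiplicity_decomposeI[OF refl]) auto
    ultimately show "infinite {s. c s = c k}"
      using range_inj_infinite[of f] finite_subset[of "range f" "{s. c s = c k}"] by auto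
  qed
  have "E \<in> E_infty P I \<longleftrightarrow> E \<in> R" for E
  proof (cases "inf_equiv E")
    case True
    have classes: "(\<forall>n. \<forall>X \<in> UNIV // E. Inf X \<in> P n \<longrightarrow> X \<subseteq> (\<Union>m \<in> I n. P m)) \<longleftrightarrow>
        (\<forall>x. col x \<in> I (col (lead E x)))" (is "?L \<longleftrightarrow> ?R")
    proof
      assume L: ?L
      show ?R
      proof
        fix x
        have "E `` {x} \<subseteq> (\<Union>m \<in> I (col (lead E x)). P m)"
          using L by (auto simp: quotientI col lead_def)
        moreover have "x \<in> E `` {x}" using inf_equivD[OF True] by (auto simp: equiv_def refl_on_def)
        ultimately show "col x \<in> I (col (lead E x))" by (auto simp: col)
      qed
    next
      assume R: ?R
      show ?L
      proof (intro allI ballI impI subsetI)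
        fix n X y assume X: "X \<in> UNIV // E" "Inf X \<in> P n" "y \<in> X"
        then obtain x where x: "X = E `` {x}" by (auto simp: quotient_def)
        then have "lead E y = lead E x"
          using X(3) lead_eq_iff[OF inf_equivD[OF True], of x y] by simp
        then show "y \<in> (\<Union>m \<in> I n. P m)"
          using R[rule_format, of y] X(2) by (simp add: x col lead_def)
      qed
    qed
    have lead_idx: "(\<forall>x. col x \<in> I (col (lead E x))) \<longleftrightarrow> (\<forall>x. col x \<in> I (c (idx E x)))"
      if "\<forall>k. col (p k E) = c k"
      using that p_idx[OF True] by metis
    have minima: "(\<forall>k n. p k E \<in> P n \<longleftrightarrow> 2 ^ n dvd k + 1 \<and> (\<forall>m. 2 ^ m dvd k + 1 \<longrightarrow> m \<le> n)) \<longleftrightarrow>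
        (\<forall>k. col (p k E) = c k)"
      unfolding c col by metis
    show ?thesis
      unfolding E_infty_def R_def inf_equiv_def mem_Collect_eq classes minima
      using lead_idx by (simp cong: conj_cong)
  qed (auto simp: E_infty_def R_def inf_equiv_def)
  then have "E_infty P I = R" by blast
  then show ?thesis using topological_ramsey_space_R by simp
qed

end
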